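(* Let $K$ be a totally real number field of degree $d$ over $\mathbb{Q}$, let $S$ be the set of field embeddings $K\hookrightarrow\mathbb{R}$ (so $|S|=d$), and let $\mathbf{r}=(r_\sigma)_{\sigma\in S}$ be a real vector with $r_\sigma\ge0$ for all $\sigma\in S$ and $\sum_{\sigma\in S}r_\sigma=1$. Then the set $\mathbf{Bad}(K,\mathbf{r})$ of $(K,\mathbf{r})$-badly approximable vectors is a hyperplane absolute winning (HAW) subset of $\prod_{\sigma\in S}\mathbb{R}\cong\mathbb{R}^d$.
   Context: Let $\mathcal{O}_K$ be the ring of integers of $K$, $S_1=\{\sigma\in S:r_\sigma>0\}$ and $S_2=S\setminus S_1$. For $q\in K$ put $\|q\|_{\mathbf{r}}=\max_{\sigma\in S_1}|\sigma(q)|^{1/r_\sigma}$. A vector $\mathbf{x}=(x_\sigma)_{\sigma\in S}\in\prod_{\sigma\in S}\mathbb{R}$ is $(K,\mathbf{r})$-badly approximable if $$\inf_{\substack{q\in\mathcal{O}_K\setminus\{0\}\\ p\in\mathcal{O}_K}}\max\Big\{\max_{\sigma\in S_1}\|q\|_{\mathbf{r}}^{r_\sigma}|\sigma(q)x_\sigma+\sigma(p)|,\ \max_{\sigma\in S_2}\max\{|\sigma(q)x_\sigma+\sigma(p)|,|\sigma(q)|\}\Big\}>0$$ (the $S_2$-term is omitted if $S_2=\emptyset$). The set of these vectors is $\mathbf{Bad}(K,\mathbf{r})$. Hyperplane absolute game. For an affine hyperplane $L\subset\mathbb{R}^d$ and $\delta>0$, let $L^{(\delta)}=\{\mathbf{x}\in\mathbb{R}^d:\mathrm{dist}(\mathbf{x},L)<\delta\}$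 (Euclidean distance). Let $\beta\in(0,\frac13)$. In the $\beta$-hyperplane absolute game on $\mathbb{R}^d$, Bob starts by choosing a closed ball $B_0\subset\mathbb{R}^d$ of radius $\rho_0>0$. In the $i$-th turn, after Bob has chosen a closed ball $B_i$ of radius $\rho_i$, Alice chooses a hyperplane neighborhood $L_i^{(\delta_i)}$ with $\delta_i\le\beta\rho_i$; then Bob chooses a closed ball $B_{i+1}\subset B_i\setminus L_i^{(\delta_i)}$ of radius $\rho_{i+1}\ge\beta\rho_i$. A subset $A\subset\mathbb{R}^d$ is $\beta$-HAW if, no matter how Bob plays, Alice can ensure $\bigcap_{i\ge0}B_i\cap A\neq\emptyset$; it is HAW if it is $\beta$-HAW for every $\beta\in(0,\frac13)$. *)

theory Defs
  imports "HOL-Analysis.Analysis" "HOL-Computational_Algebra.Polynomial"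
begin

section \<open>Totally real number fields\<close>

(* A number field is a type 'k of characteristic 0 that is a finite-dimensional vector space
   over the rationals; d is the size of a basis. *)
definition number_field_of_degree :: "'k::field_char_0 itself \<Rightarrow> nat \<Rightarrow> bool" where
  "number_field_of_degree _ d \<longleftrightarrow>
     (\<exists>B :: 'k set. finite_dimensional_vector_space (\<lambda>(c::rat) (x::'k). of_rat c * x) B \<and> card B = d)"

definition field_embeddings :: "('k::field \<Rightarrow> 'l::field) set" where
  "field_embeddings =
     {\<sigma>. \<sigma> 1 = 1 \<and> (\<forall>x y. \<sigma> (x + y) = \<sigma> x + \<sigma> y) \<and> (\<forall>x y. \<sigma> (x * y) = \<sigma> x * \<sigma> y)}"

definition totally_real :: "'k::field_char_0 itself \<Rightarrow> bool" where
  "totally_real _ \<longleftrightarrow> (\<forall>\<sigma> \<in> (field_embeddings :: ('k \<Rightarrow> complex) set). range \<sigma> \<subseteq> \<real>)"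

abbreviation real_embeddings :: "('k::field_char_0 \<Rightarrow> real) set" where
  "real_embeddings \<equiv> field_embeddings"

definition ring_of_integers :: "'k::field_char_0 set" where
  "ring_of_integers = {x. algebraic_int x}"


section \<open>Badly approximable vectors\<close>

(* Weights and vectors indexed by S are functions on embeddings; weights only matter on S. *)
definition S1 :: "(('k::field_char_0 \<Rightarrow> real) \<Rightarrow> real) \<Rightarrow> ('k \<Rightarrow> real) set" where
  "S1 r = {\<sigma> \<in> real_embeddings. r \<sigma> > 0}"

definition S2 :: "(('k::field_char_0 \<Rightarrow> real) \<Rightarrow> real) \<Rightarrow> ('k \<Rightarrow> real) set" where
  "S2 r = real_embeddings - S1 r"

definition weighted_norm :: "(('k::field_char_0 \<Rightarrow> real) \<Rightarrow> real) \<Rightarrow> 'k \<Rightarrow> real" where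
  "weighted_norm r q = (MAX \<sigma>\<in>S1 r. \<bar>\<sigma> q\<bar> powr (1 / r \<sigma>))"

definition approx_quality ::
  "(('k::field_char_0 \<Rightarrow> real) \<Rightarrow> real) \<Rightarrow> (('k \<Rightarrow> real) \<Rightarrow> real) \<Rightarrow> 'k \<Rightarrow> 'k \<Rightarrow> real" where
  "approx_quality r x q p =
     (let m1 = (MAX \<sigma>\<in>S1 r. weighted_norm r q powr r \<sigma> * \<bar>\<sigma> q * x \<sigma> + \<sigma> p\<bar>);
          m2 = (MAX \<sigma>\<in>S2 r. max \<bar>\<sigma> q * x \<sigma> + \<sigma> p\<bar> \<bar>\<sigma> q\<bar>)
      in if S2 r = {} then m1 else max m1 m2)"

definition Bad :: "(('k::field_char_0 \<Rightarrow> real) \<Rightarrow> real) \<Rightarrow> (('k \<Rightarrow> real) \<Rightarrow> real) set" where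
  "Bad r = {x \<in> real_embeddings \<rightarrow>\<^sub>E UNIV.
     (INF (q, p) \<in> (ring_of_integers - {0}) \<times> ring_of_integers. approx_quality r x q p) > 0}"


section \<open>The hyperplane absolute game\<close>

definition affine_hyperplane :: "'a::euclidean_space set \<Rightarrow> bool" where
  "affine_hyperplane L \<longleftrightarrow> (\<exists>a b. a \<noteq> 0 \<and> L = {x. a \<bullet> x = b})"

definition neighborhood :: "'a::euclidean_space set \<Rightarrow> real \<Rightarrow> 'a set" where
  "neighborhood L \<delta> = {x. infdist x L < \<delta>}"

(* Bob's ball with centre c and radius rho is encoded as (c, rho), Alice's choice as (L, delta).
   A strategy for Alice sees the list of all balls Bob has chosen so far (latest last). It must
   give an admissible move for every history, so that Alice cannot stall the game. *)
type_synonym 'a alice_strategy = "('a \<times> real) list \<Rightarrow> 'a set \<times> real"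

definition legal_strategy :: "real \<Rightarrow> 'a::euclidean_space alice_strategy \<Rightarrow> bool" where
  "legal_strategy \<beta> s \<longleftrightarrow>
     (\<forall>h. h \<noteq> [] \<and> snd (last h) > 0 \<longrightarrow>
        affine_hyperplane (fst (s h)) \<and> 0 < snd (s h) \<and> snd (s h) \<le> \<beta> * snd (last h))"

definition bob_play ::
  "real \<Rightarrow> 'a::euclidean_space alice_strategy \<Rightarrow> (nat \<Rightarrow> 'a) \<Rightarrow> (nat \<Rightarrow> real) \<Rightarrow> bool" where
  "bob_play \<beta> s c \<rho> \<longleftrightarrow> \<rho> 0 > 0 \<and>
     (\<forall>i. let (L, \<delta>) = s (map (\<lambda>j. (c j, \<rho> j)) [0..<Suc i])
          in \<rho> (Suc i) \<ge> \<beta> * \<rho> i \<and>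
             cball (c (Suc i)) (\<rho> (Suc i)) \<subseteq> cball (c i) (\<rho> i) - neighborhood L \<delta>)"

definition beta_HAW :: "real \<Rightarrow> 'a::euclidean_space set \<Rightarrow> bool" where
  "beta_HAW \<beta> A \<longleftrightarrow>
     (\<exists>s. legal_strategy \<beta> s \<and>
        (\<forall>c \<rho>. bob_play \<beta> s c \<rho> \<longrightarrow> (\<Inter>i. cball (c i) (\<rho> i)) \<inter> A \<noteq> {}))"

definition HAW :: "'a::euclidean_space set \<Rightarrow> bool" where
  "HAW A \<longleftrightarrow> (\<forall>\<beta>. 0 < \<beta> \<and> \<beta> < 1/3 \<longrightarrow> beta_HAW \<beta> A)"


section \<open>Coordinates\<close>

(* The identification of the product over S of copies of the reals with Euclidean space
   given by an enumeration e of S. *)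
definition coordinates ::
  "('n::finite \<Rightarrow> 'k \<Rightarrow> real) \<Rightarrow> (('k \<Rightarrow> real) \<Rightarrow> real) \<Rightarrow> real ^ 'n" where
  "coordinates e x = (\<chi> i. x (e i))"

end

theory Submission
  imports Defs "HOL-Computational_Algebra.Fundamental_Theorem_Algebra"
begin

text \<open>
  A point fails to be badly approximable only if, for every \<open>\<epsilon>\<close>, it lies in a box around a fraction \<open>- p / q\<close>.
  Group the pairs \<open>(p, q)\<close> into classes according to the approximate sizes of all \<open>\<sigma> q\<close>. If two fractions of one
  class have boxes meeting the same ball, whose radius is comparable to the thinnest side of these boxes, then
  \<open>p * q' - p' * q\<close> has norm less than 1, so the fractions agree; the class is then confined to one thin neighborhood
  of a coordinate hyperplane. Moreover, if \<open>k\<close> is the logarithmic defect of \<open>q\<close>, this remains true for balls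
  larger by a factor exponential in \<open>k\<close>, while only polynomially many classes with defect \<open>k\<close> have a given scale.

  Alice therefore keeps under control the potential obtained by summing a small power \<open>\<gamma>\<close> of the thickness over all
  classes that still meet Bob's ball. Playing weighted medians, she decreases it by a constant factor, and for
  small \<open>\<gamma>\<close> this outweighs the loss caused by the shrinking of the ball and the newly arriving classes. So the potential
  stays below a multiple of the \<open>\<gamma>\<close>-th power of the radius, and every class is eventually avoided.
\<close>

section \<open>Embeddings of a number field\<close>

text \<open>The bound 1 for norms concerns the product over the real embeddings and requires exactly
  as many of them as the degree. Both facts come from one source: every rational-linear functional
  on the field is a complex combination of embeddings. Hence the matrix of conjugates of a basis is
  invertible, and it diagonalizes multiplication by any element.

  The obstacle in the game is that the thinnest side of a box points in a direction depending on the
  class, and one ball may meet boxes of all directions, while Alice removes a single hyperplane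
  neighborhood per turn. No move can clear them all, so the argument works with total weight: the
  heaviest of the \<open>CARD('n)\<close> directions holds at least its share of the potential, and
  a median move discards half of that share. The exponent \<gamma> is fitted to this modest gain. It
  suffices because in the end a point inside a dangerous set would contribute a fixed positive
  weight to a potential that tends to 0.\<close>

lemma of_rat_poly_pCons:
  "poly (map_poly of_rat (pCons a p)) (x::'a::field_char_0) = of_rat a + x * poly (map_poly of_rat p) x"
  by (simp add: map_poly_pCons)

lemma of_rat_poly_add:
  "poly (map_poly of_rat (p + q)) (x::'a::field_char_0) = poly (map_poly of_rat p) x + poly (map_poly of_rat q) x"
proof -
  have "map_poly of_rat (p + q) = (map_poly of_rat p + map_poly of_rat q :: 'a poly)"
    by (intro poly_eqI) (simp add: coeff_map_poly of_rat_add)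
  then show ?thesis by simp
qed

lemma of_rat_poly_smult:
  "poly (map_poly of_rat (smult a p)) (x::'a::field_char_0) = of_rat a * poly (map_poly of_rat p) x"
proof -
  have "map_poly of_rat (smult a p) = (smult (of_rat a) (map_poly of_rat p) :: 'a poly)"
    by (intro poly_eqI) (simp add: coeff_map_poly of_rat_mult)
  then show ?thesis by simp
qed

lemma of_rat_poly_mult:
  "poly (map_poly of_rat (p * q)) (x::'a::field_char_0) = poly (map_poly of_rat p) x * poly (map_poly of_rat q) x"
  by (induction p) (simp_all add: of_rat_poly_pCons of_rat_poly_add of_rat_poly_smult algebra_simps)

lemma of_rat_poly_pderiv:
  "map_poly of_rat (pderiv p) = (pderiv (map_poly of_rat p) :: 'a::field_char_0 poly)"
  by (intro poly_eqI) (simp add: coeff_map_poly coeff_pderiv of_rat_mult of_rat_add)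

lemma of_rat_poly_const:
  assumes "degree p = 0" "p \<noteq> 0"
  shows "poly (map_poly of_rat p) (x::'a::field_char_0) \<noteq> 0"
  using assms by (elim degree_eq_zeroE) (auto simp: of_rat_poly_pCons)

lemma minimal_rat_poly_dvd:
  fixes z :: "'a::field_char_0"
  assumes g: "g \<noteq> 0" "poly (map_poly of_rat g) z = 0"
    and min: "\<And>f. f \<noteq> 0 \<Longrightarrow> poly (map_poly of_rat f) z = 0 \<Longrightarrow> degree g \<le> degree f"
    and p: "poly (map_poly of_rat p) z = 0"
  shows "g dvd p"
proof -
  have "poly (map_poly of_rat p) z = poly (map_poly of_rat (p mod g)) z"
    using g(2) of_rat_poly_add[of "g * (p div g)" "p mod g" z] by (simp add: of_rat_poly_mult)
  then have "p mod g = 0 \<or> degree g \<le> degree (p mod g)"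
    using min p by auto
  then show ?thesis
    using degree_mod_less[OF g(1), of p] by (auto simp: dvd_eq_mod_eq_0 leD)
qed

text \<open>A double root \<open>z\<close> in the other field is also a root of
  \<open>pderiv p\<close>, so the minimal polynomial \<open>g\<close> of \<open>z\<close> is a
  proper divisor of \<open>p\<close>. Then \<open>g\<close> or its cofactor annihilates \<alpha>
  with smaller degree than the minimal choice \<open>p\<close>.\<close>

lemma separable_annihilator:
  fixes \<alpha> :: "'k::field_char_0"
  assumes "\<exists>p::rat poly. p \<noteq> 0 \<and> poly (map_poly of_rat p) \<alpha> = 0"
  obtains p :: "rat poly" where "p \<noteq> 0" "poly (map_poly of_rat p) \<alpha> = 0"
    "rsquarefree (map_poly of_rat p :: 'c::field_char_0 poly)"
proof -
  obtain p :: "rat poly" where p: "p \<noteq> 0" "poly (map_poly of_rat p) \<alpha> = 0"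
    and pmin: "\<And>f. f \<noteq> 0 \<Longrightarrow> poly (map_poly of_rat f) \<alpha> = 0 \<Longrightarrow> degree p \<le> degree f"
    using ex_has_least_nat[of "\<lambda>p. p \<noteq> (0::rat poly) \<and> poly (map_poly of_rat p) \<alpha> = 0" _ degree] assms
    by blast
  have "rsquarefree (map_poly of_rat p :: 'c poly)"
  proof (rule ccontr)
    assume "\<not> ?thesis"
    then obtain z :: 'c where z: "poly (map_poly of_rat p) z = 0" "poly (map_poly of_rat (pderiv p)) z = 0"
      by (auto simp: rsquarefree_roots of_rat_poly_pderiv)
    obtain g :: "rat poly" where g: "g \<noteq> 0" "poly (map_poly of_rat g) z = 0"
      and gmin: "\<And>f. f \<noteq> 0 \<Longrightarrow> poly (map_poly of_rat f) z = 0 \<Longrightarrow> degree g \<le> degree f"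
      using ex_has_least_nat[of "\<lambda>p. p \<noteq> (0::rat poly) \<and> poly (map_poly of_rat p) z = 0" _ degree] z(1) p(1)
      by blast
    have "degree p \<noteq> 0" using of_rat_poly_const p by auto
    then have "pderiv p \<noteq> 0" by (simp add: pderiv_eq_0_iff)
    then have "degree g < degree p"
      using gmin[of "pderiv p"] z \<open>degree p \<noteq> 0\<close> by (simp add: degree_pderiv)
    moreover have "degree g \<noteq> 0" using of_rat_poly_const g by auto
    moreover obtain h where h: "p = g * h"
      using minimal_rat_poly_dvd[OF g gmin z(1)] by (auto elim: dvdE)
    ultimately have "degree h < degree p" "g \<noteq> 0" "h \<noteq> 0"
      using p by (auto simp: degree_mult_eq)
    moreover have "poly (map_poly of_rat g) \<alpha> = 0 \<or> poly (map_poly of_rat h) \<alpha> = 0"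
      using p(2) unfolding h by (simp add: of_rat_poly_mult)
    ultimately show False
      using pmin[of g] pmin[of h] \<open>degree g < degree p\<close> by auto
  qed
  then show ?thesis using that p by blast
qed

text \<open>The polynomial \<open>h\<close> in the operator
  \<open>g \<mapsto> (\<lambda>x. g (\<alpha> * x))\<close>, applied to \<open>g\<close>.\<close>

definition poly_act :: "'k::field \<Rightarrow> complex poly \<Rightarrow> ('k \<Rightarrow> complex) \<Rightarrow> 'k \<Rightarrow> complex" where
  "poly_act \<alpha> h g x = (\<Sum>m\<le>degree h. coeff h m * g (\<alpha> ^ m * x))"

lemma poly_act_bound:
  assumes "degree h \<le> n"
  shows "poly_act \<alpha> h g x = (\<Sum>m\<le>n. coeff h m * g (\<alpha> ^ m * x))"
  unfolding poly_act_def using assms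
  by (intro sum.mono_neutral_left) (auto simp: coeff_eq_0)

lemma poly_act_linear_factor:
  "poly_act \<alpha> ([:-l, 1:] * h) g = poly_act \<alpha> h (\<lambda>x. g (\<alpha> * x) - l * g x)"
proof
  fix x
  have d: "degree ([:-l, 1:] * h) \<le> Suc (degree h)"
    by (rule order.trans[OF degree_mult_le]) simp
  have c: "coeff ([:-l, 1:] * h) m = (case m of 0 \<Rightarrow> 0 | Suc j \<Rightarrow> coeff h j) - l * coeff h m" for m
    by (simp add: coeff_pCons split: nat.split)
  have "poly_act \<alpha> ([:-l, 1:] * h) g x =
    (\<Sum>m\<le>Suc (degree h). (case m of 0 \<Rightarrow> 0 | Suc j \<Rightarrow> coeff h j) * g (\<alpha> ^ m * x)) -
    (\<Sum>m\<le>Suc (degree h). l * coeff h m * g (\<alpha> ^ m * x))"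
    unfolding poly_act_bound[OF d] c by (simp only: left_diff_distrib sum_subtractf)
  also have "\<dots> = (\<Sum>m\<le>degree h. coeff h m * g (\<alpha> ^ m * (\<alpha> * x))) - (\<Sum>m\<le>degree h. l * coeff h m * g (\<alpha> ^ m * x))"
    by (subst sum.atMost_Suc_shift, subst sum.atMost_Suc) (simp add: coeff_eq_0 mult_ac)
  finally show "poly_act \<alpha> ([:-l, 1:] * h) g x = poly_act \<alpha> h (\<lambda>x. g (\<alpha> * x) - l * g x) x"
    by (simp add: poly_act_def algebra_simps sum_subtractf)
qed

text \<open>Induction over the eigenvalues: the operator minus \<open>a\<close> removes the factor
  of \<open>a\<close>, and the image splits by induction. The set \<open>U\<close> carries along
  eigenvector conditions for other operators, so that several can be diagonalized in turn.\<close>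

lemma eigen_decomposition:
  assumes "finite \<Lambda>"
    and "\<And>g h. g \<in> U \<Longrightarrow> h \<in> U \<Longrightarrow> (\<lambda>x. g x + h x) \<in> U"
    and "\<And>g c. g \<in> U \<Longrightarrow> (\<lambda>x. c * g x) \<in> U"
    and "\<And>g. g \<in> U \<Longrightarrow> (\<lambda>x. g (\<alpha> * x)) \<in> U"
    and "(\<lambda>x. 0) \<in> U"
    and "g \<in> U" and "poly_act \<alpha> (\<Prod>l\<in>\<Lambda>. [:-l, 1:]) g = (\<lambda>x. 0)"
  shows "\<exists>G. (\<forall>l\<in>\<Lambda>. G l \<in> U \<and> (\<forall>x. G l (\<alpha> * x) = l * G l x)) \<and> g = (\<lambda>x. \<Sum>l\<in>\<Lambda>. G l x)"
  using assms(1,6,7)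
proof (induction \<Lambda> arbitrary: g rule: finite_induct)
  case empty
  then show ?case by (auto simp: poly_act_def fun_eq_iff)
next
  case (insert a \<Lambda>)
  note add = assms(2) and scale = assms(3) and shift = assms(4) and zero = assms(5)
  define h where "h = (\<lambda>x. g (\<alpha> * x) - a * g x)"
  have hU: "h \<in> U"
    using add[OF shift[OF insert.prems(1)] scale[OF insert.prems(1), of "-a"]] by (simp add: h_def)
  have "poly_act \<alpha> (\<Prod>l\<in>\<Lambda>. [:-l, 1:]) h = (\<lambda>x. 0)"
    using insert.prems(2) insert.hyps by (simp add: poly_act_linear_factor[of \<alpha> a] h_def del: mult_pCons_left)
  from insert.IH[OF hU this] obtain G where
    G: "\<And>l. l \<in> \<Lambda> \<Longrightarrow> G l \<in> U" "\<And>l x. l \<in> \<Lambda> \<Longrightarrow> G l (\<alpha> * x) = l * G l x"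
    and hG: "h = (\<lambda>x. \<Sum>l\<in>\<Lambda>. G l x)"
    by blast
  \<comment> \<open>The operator minus \<open>a\<close> multiplies \<open>G l\<close> by
    \<open>l - a\<close>, so division by \<open>l - a\<close> inverts it there; what remains of
    \<open>g\<close> is killed by it and is the component for \<open>a\<close>.\<close>
  define G' where "G' l = (if l = a then (\<lambda>x. g x - (\<Sum>l\<in>\<Lambda>. G l x / (l - a))) else (\<lambda>x. G l x / (l - a)))" for l
  have GU: "(\<lambda>x. G l x / (l - a)) \<in> U" if "l \<in> \<Lambda>" for l
    using scale[OF G(1)[OF that], of "1 / (l - a)"] by simp
  have "(\<lambda>x. \<Sum>l\<in>L. G l x / (l - a)) \<in> U" if "L \<subseteq> \<Lambda>" for L
    using finite_subset[OF that insert.hyps(1)] that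
    by (induction L rule: finite_induct) (auto simp: zero intro!: add GU)
  then have "G' a \<in> U"
    using add[OF insert.prems(1) scale[of _ "-1"]] by (simp add: G'_def)
  moreover have "G' a (\<alpha> * x) = a * G' a x" for x
  proof -
    have "(\<Sum>l\<in>\<Lambda>. G l (\<alpha> * x) / (l - a)) = (\<Sum>l\<in>\<Lambda>. G l x + a * (G l x / (l - a)))"
    proof (intro sum.cong refl)
      fix l assume l: "l \<in> \<Lambda>"
      then have "l - a \<noteq> 0" using insert.hyps by auto
      then show "G l (\<alpha> * x) / (l - a) = G l x + a * (G l x / (l - a))"
        unfolding G(2)[OF l] by (simp add: field_simps)
    qed
    also have "\<dots> = h x + a * (\<Sum>l\<in>\<Lambda>. G l x / (l - a))"
      by (simp add: hG sum.distrib sum_distrib_left)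
    finally show ?thesis
      by (simp add: G'_def h_def algebra_simps)
  qed
  moreover have "G' l \<in> U \<and> (\<forall>x. G' l (\<alpha> * x) = l * G' l x)" if "l \<in> \<Lambda>" for l
    using that insert.hyps GU[OF that] G(2)[OF that] by (auto simp: G'_def)
  moreover have "g = (\<lambda>x. \<Sum>l\<in>insert a \<Lambda>. G' l x)"
  proof
    fix x
    have "(\<Sum>l\<in>\<Lambda>. G' l x) = (\<Sum>l\<in>\<Lambda>. G l x / (l - a))"
      using insert.hyps by (intro sum.cong) (auto simp: G'_def)
    then show "g x = (\<Sum>l\<in>insert a \<Lambda>. G' l x)"
      using insert.hyps by (simp add: G'_def)
  qed
  ultimately show ?case by (intro exI[of _ G']) auto
qed

section \<open>Field embeddings and their linear independence\<close>

lemma field_embeddingsD: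
  assumes "\<sigma> \<in> field_embeddings"
  shows "\<sigma> 1 = 1" "\<sigma> (x + y) = \<sigma> x + \<sigma> y" "\<sigma> (x * y) = \<sigma> x * \<sigma> y"
  using assms by (auto simp: field_embeddings_def)

lemma field_embedding_simps:
  fixes \<sigma> :: "'k::field_char_0 \<Rightarrow> 'l::field_char_0"
  assumes \<sigma>: "\<sigma> \<in> field_embeddings"
  shows "\<sigma> 0 = 0" "\<sigma> (- x) = - \<sigma> x" "\<sigma> (x - y) = \<sigma> x - \<sigma> y" "\<sigma> (x ^ n) = \<sigma> x ^ n"
    "\<sigma> x = 0 \<longleftrightarrow> x = 0" "\<sigma> (sum g A) = (\<Sum>i\<in>A. \<sigma> (g i))"
    "\<sigma> (of_rat c) = of_rat c"
proof -
  note h = field_embeddingsD[OF \<sigma>]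
  show z: "\<sigma> 0 = 0" using h(2)[of 0 0] by simp
  show m: "\<sigma> (- x) = - \<sigma> x" for x using h(2)[of x "-x"] z by (simp add: eq_neg_iff_add_eq_0 add.commute)
  show "\<sigma> (x - y) = \<sigma> x - \<sigma> y" using h(2)[of x "-y"] m by simp
  show "\<sigma> (x ^ n) = \<sigma> x ^ n" by (induction n) (simp_all add: h)
  show iff: "\<sigma> x = 0 \<longleftrightarrow> x = 0" for x using h(3)[of x "inverse x"] h(1) z by (cases "x = 0") auto
  show "\<sigma> (sum g A) = (\<Sum>i\<in>A. \<sigma> (g i))"
    by (induction A rule: infinite_finite_induct) (auto simp: z h(2))
  have n: "\<sigma> (of_nat n) = of_nat n" for n by (induction n) (simp_all add: h z)
  have i: "\<sigma> (of_int n) = of_int n" for n by (cases n rule: int_cases2) (simp_all add: n m)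
  obtain a b where ab: "c = of_int a / of_int b" "b > 0"
    by (metis Fract_of_int_quotient Rat_cases)
  have "\<sigma> (of_rat c) * of_int b = \<sigma> (of_rat c * of_int b)" using i h by metis
  also have "of_rat c * of_int b = (of_int a :: 'k)" using ab by (simp add: of_rat_divide)
  finally have "\<sigma> (of_rat c) * of_int b = of_int a" using i by simp
  then show "\<sigma> (of_rat c) = of_rat c" using ab(2) unfolding ab(1) by (simp add: of_rat_divide field_simps)
qed

lemma dedekind_independence:
  fixes a :: "('k::field_char_0 \<Rightarrow> 'l::field_char_0) \<Rightarrow> 'l"
  assumes "finite F" "F \<subseteq> field_embeddings" "\<And>x. (\<Sum>\<sigma>\<in>F. a \<sigma> * \<sigma> x) = 0" "\<tau> \<in> F"
  shows "a \<tau> = 0"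
  using assms
proof (induction F arbitrary: a \<tau> rule: finite_induct)
  case (insert \<phi> F)
  note emb = subsetD[OF insert.prems(1)]
  have rest: "a \<sigma> = 0" if \<sigma>: "\<sigma> \<in> F" for \<sigma>
  proof -
    have "\<sigma> \<noteq> \<phi>" using \<sigma> insert.hyps by blast
    then obtain y where y: "\<sigma> y \<noteq> \<phi> y" by blast
    have "(\<Sum>\<tau>\<in>F. (a \<tau> * (\<tau> y - \<phi> y)) * \<tau> x) = 0" for x
    proof -
      have "(\<Sum>\<tau>\<in>F. (a \<tau> * (\<tau> y - \<phi> y)) * \<tau> x) = (\<Sum>\<tau>\<in>insert \<phi> F. (a \<tau> * (\<tau> y - \<phi> y)) * \<tau> x)"
        using insert.hyps by simp
      also have "\<dots> = (\<Sum>\<tau>\<in>insert \<phi> F. a \<tau> * \<tau> (y * x) - \<phi> y * (a \<tau> * \<tau> x))"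
        by (intro sum.cong) (auto simp: field_embeddingsD[OF emb] algebra_simps)
      also have "\<dots> = 0"
        using insert.prems(2) by (simp only: sum_subtractf sum_distrib_left[symmetric]) simp
      finally show ?thesis .
    qed
    from insert.IH[OF _ this \<sigma>] insert.prems(1) y show ?thesis by auto
  qed
  have "a \<phi> = 0"
    using insert.prems(2)[of 1] rest insert.hyps field_embeddingsD(1)[OF emb, of \<phi>] by simp
  then show ?case using insert.prems(3) rest by blast
qed simp

section \<open>Rational-linear functionals as combinations of embeddings\<close>

locale number_field_basis =
  finite_dimensional_vector_space "\<lambda>(c::rat) (x::'k). of_rat c * x" B
  for B :: "'k::field_char_0 set"
begin

abbreviation coord :: "'k \<Rightarrow> 'k \<Rightarrow> rat" where
  "coord \<equiv> representation B"

lemma coord_sum: "(\<Sum>b\<in>B. of_rat (coord x b) * b) = x"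
  by (rule sum_representation_eq) (use finite_Basis independent_Basis span_Basis in auto)

lemma coord_add: "coord (x + y) b = coord x b + coord y b"
  using representation_add[OF independent_Basis, of y x] span_Basis by simp

lemma coord_scale: "coord (of_rat c * x) b = c * coord x b"
  using representation_scale[OF independent_Basis, of x c] span_Basis by simp

text \<open>\<open>card B + 1\<close> powers of \<alpha> are dependent. Since
  \<open>dependent\<close> speaks of a set of vectors, a repetition among the powers is treated
  apart; it gives a difference of two monomials.\<close>

lemma exists_rat_poly: "\<exists>p::rat poly. p \<noteq> 0 \<and> poly (map_poly of_rat p) (\<alpha>::'k) = 0"
proof (cases "inj_on (\<lambda>n. \<alpha> ^ n) {..card B}")
  case True
  then have "card ((\<lambda>n. \<alpha> ^ n) ` {..card B}) = Suc (card B)" by (simp add: card_image)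
  then have "dependent ((\<lambda>n. \<alpha> ^ n) ` {..card B})"
    using independent_card_le_dim[of "(\<lambda>n. \<alpha> ^ n) ` {..card B}" UNIV] by (auto simp: dim_UNIV)
  then obtain u where u: "\<exists>v\<in>(\<lambda>n. \<alpha> ^ n) ` {..card B}. u v \<noteq> 0"
    "(\<Sum>v\<in>(\<lambda>n. \<alpha> ^ n) ` {..card B}. of_rat (u v) * v) = 0"
    by (auto simp: dependent_finite)
  define p where "p = (\<Sum>n\<le>card B. monom (u (\<alpha> ^ n)) n)"
  have c: "coeff p n = (if n \<le> card B then u (\<alpha> ^ n) else 0)" for n
    by (simp add: p_def coeff_sum sum.delta' if_distrib cong: if_cong)
  have "p \<noteq> 0" using u(1) c by (metis coeff_0 imageE atMost_iff)
  moreover have "poly (map_poly of_rat p) \<alpha> = 0"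
  proof -
    have "degree (map_poly of_rat p :: 'k poly) \<le> card B"
      by (intro degree_le) (simp add: coeff_map_poly c)
    then have "poly (map_poly of_rat p) \<alpha> = (\<Sum>n\<le>card B. of_rat (u (\<alpha> ^ n)) * \<alpha> ^ n)"
      unfolding poly_altdef
      by (subst sum.mono_neutral_left[of "{..card B}"]) (auto simp: coeff_map_poly c coeff_eq_0)
    also have "\<dots> = 0" using u(2) True by (simp add: sum.reindex)
    finally show ?thesis .
  qed
  ultimately show ?thesis by blast
next
  case False
  then obtain m n where mn: "m \<noteq> n" "\<alpha> ^ m = \<alpha> ^ n" by (auto simp: inj_on_def)
  have "coeff (monom 1 m - monom (1::rat) n) m = 1" using mn by simp
  then have "monom 1 m - monom (1::rat) n \<noteq> 0" by (metis coeff_0 zero_neq_one)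
  moreover have "map_poly of_rat (monom 1 m - monom (1::rat) n) = (monom 1 m - monom 1 n :: 'k poly)"
    by (intro poly_eqI) (simp add: coeff_map_poly of_rat_diff)
  ultimately show ?thesis using mn by (intro exI[of _ "monom 1 m - monom 1 n"]) (simp add: poly_monom)
qed

definition rat_linear :: "('k \<Rightarrow> complex) \<Rightarrow> bool" where
  "rat_linear f \<longleftrightarrow> (\<forall>x y. f (x + y) = f x + f y) \<and> (\<forall>c x. f (of_rat c * x) = of_rat c * f x)"

lemma rat_linear_sum:
  assumes "rat_linear f"
  shows "f (sum g A) = (\<Sum>i\<in>A. f (g i))"
proof -
  have "f 0 = 0" using assms unfolding rat_linear_def by (metis add_cancel_right_left)
  then show ?thesis using assms
    by (induction A rule: infinite_finite_induct) (auto simp: rat_linear_def)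
qed

text \<open>A sum over an infinite set is 0, so this is the span only for finitely many embeddings;
  the lemmas that place a functional in it assume finiteness.\<close>

definition emb_span :: "('k \<Rightarrow> complex) set" where
  "emb_span = {f. \<exists>c. f = (\<lambda>x. \<Sum>\<sigma>\<in>field_embeddings. c \<sigma> * \<sigma> x)}"

lemma emb_span_zero: "(\<lambda>x. 0) \<in> emb_span"
  unfolding emb_span_def by (auto intro!: exI[of _ "\<lambda>_. 0"])

lemma emb_span_add: "f \<in> emb_span \<Longrightarrow> g \<in> emb_span \<Longrightarrow> (\<lambda>x. f x + g x) \<in> emb_span"
proof -
  assume "f \<in> emb_span" "g \<in> emb_span"
  then obtain c c' where "f = (\<lambda>x. \<Sum>\<sigma>\<in>field_embeddings. c \<sigma> * \<sigma> x)"
    "g = (\<lambda>x. \<Sum>\<sigma>\<in>field_embeddings. c' \<sigma> * \<sigma> x)"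
    by (auto simp: emb_span_def)
  then have "(\<lambda>x. f x + g x) = (\<lambda>x. \<Sum>\<sigma>\<in>field_embeddings. (c \<sigma> + c' \<sigma>) * \<sigma> x)"
    by (simp add: sum.distrib distrib_right)
  then show ?thesis
    unfolding emb_span_def by (intro CollectI exI)
qed

text \<open>By linearity the eigenvalues on \<open>B\<close> extend to an eigenvalue
  \<open>\<psi> a\<close> for every \<open>a\<close>. Hence \<open>g\<close> divided by
  \<open>g 1\<close> equals \<psi> and is multiplicative, that is, an embedding; if
  \<open>g 1 = 0\<close>, then \<open>g\<close> vanishes.\<close>

lemma joint_eigenvector_in_emb_span:
  assumes fin: "finite (field_embeddings :: ('k \<Rightarrow> complex) set)"
    and g: "rat_linear g" "\<And>b x. b \<in> B \<Longrightarrow> g (b * x) = \<eta> b * g x"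
  shows "g \<in> emb_span"
proof -
  define \<psi> where "\<psi> a = (\<Sum>b\<in>B. of_rat (coord a b) * \<eta> b)" for a
  have eig: "g (a * x) = \<psi> a * g x" for a x
  proof -
    have "g (a * x) = g (\<Sum>b\<in>B. of_rat (coord a b) * (b * x))"
      by (subst coord_sum[of a, symmetric]) (simp add: sum_distrib_right mult.assoc)
    also have "\<dots> = (\<Sum>b\<in>B. of_rat (coord a b) * g (b * x))"
      using g(1) by (simp add: rat_linear_sum) (simp add: rat_linear_def)
    also have "\<dots> = \<psi> a * g x"
      by (simp add: g(2) \<psi>_def sum_distrib_right mult.assoc)
    finally show ?thesis .
  qed
  show ?thesis
  proof (cases "g 1 = 0")
    case True
    then have "g = (\<lambda>x. 0)" using eig[of _ 1] by auto
    then show ?thesis using emb_span_zero by simp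
  next
    case False
    define \<sigma> where "\<sigma> x = g x / g 1" for x
    have "\<sigma> x = \<psi> x" for x using eig[of x 1] False by (simp add: \<sigma>_def)
    then have "\<sigma> (x * y) = \<sigma> x * \<sigma> y" for x y
      using eig[of x y] unfolding \<sigma>_def by (metis times_divide_eq_right)
    then have "\<sigma> \<in> field_embeddings"
      using g(1) False unfolding field_embeddings_def rat_linear_def
      by (auto simp: \<sigma>_def add_divide_distrib)
    then have "(\<Sum>\<tau>\<in>field_embeddings. (if \<tau> = \<sigma> then g 1 else 0) * \<tau> x) = g x" for x
      using fin False by (simp add: if_distrib[of "\<lambda>a. a * _"] sum.delta' \<sigma>_def cong: if_cong)
    then show ?thesis unfolding emb_span_def
      by (auto simp: fun_eq_iff intro!: exI[of _ "\<lambda>\<tau>. if \<tau> = \<sigma> then g 1 else 0"])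
  qed
qed

text \<open>
  The operators \<open>f \<mapsto> (\<lambda>x. f (\<alpha> * x))\<close> on rational-linear functions commute, and each is diagonalizable because
  minimal polynomials are separable; a joint eigenvector is a multiple of an embedding.
\<close>

lemma rat_linear_in_emb_span:
  assumes fin: "finite (field_embeddings :: ('k \<Rightarrow> complex) set)"
  shows "rat_linear f \<Longrightarrow> f \<in> emb_span"
proof -
  \<comment> \<open>\<open>A\<close> holds elements for which \<open>g\<close> is already an
    eigenvector, \<open>C\<close> covers the basis elements still to be treated. Splitting
    \<open>g\<close> into eigenvectors for \<alpha> moves \<alpha> from \<open>C\<close> to
    \<open>A\<close>.\<close>
  have "g \<in> emb_span" if "finite C" "B \<subseteq> A \<union> C"
    "rat_linear g" "\<And>a x. a \<in> A \<Longrightarrow> g (a * x) = \<eta> a * g x" for C A \<eta> g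
    using that
  proof (induction C arbitrary: A \<eta> g rule: finite_induct)
    case empty
    then show ?case using joint_eigenvector_in_emb_span[OF fin, of g \<eta>] by auto
  next
    case (insert \<alpha> C)
    show ?case
    proof (cases "\<alpha> \<in> A")
      case True
      then show ?thesis using insert.IH[of A g \<eta>] insert.prems by auto
    next
      case False
      define U where "U = {g. rat_linear g \<and> (\<forall>a\<in>A. \<forall>x. g (a * x) = \<eta> a * g x)}"
      obtain p where p: "p \<noteq> 0" "poly (map_poly of_rat p) \<alpha> = 0"
        "rsquarefree (map_poly of_rat p :: complex poly)"
        using separable_annihilator[OF exists_rat_poly] by metis
      let ?P = "map_poly of_rat p :: complex poly"
      let ?\<Lambda> = "{z. poly ?P z = 0}"
      have P0: "?P \<noteq> 0" using p(1) by (simp add: map_poly_eq_0_iff)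
      have P: "?P = smult (lead_coeff ?P) (\<Prod>z\<in>?\<Lambda>. [:-z, 1:])"
        using complex_poly_decompose_rsquarefree[OF p(3)] by simp
      have "poly_act \<alpha> ?P g x = 0" for x
      proof -
        have "degree ?P = degree p" "degree (map_poly of_rat p :: 'k poly) = degree p"
          by (auto intro!: degree_map_poly)
        then have "poly_act \<alpha> ?P g x = (\<Sum>m\<le>degree p. of_rat (coeff p m) * g (\<alpha> ^ m * x))"
          by (simp add: poly_act_def coeff_map_poly)
        also have "\<dots> = g (\<Sum>m\<le>degree p. of_rat (coeff p m) * (\<alpha> ^ m * x))"
          using insert.prems(2) by (simp add: rat_linear_sum) (simp add: rat_linear_def)
        also have "(\<Sum>m\<le>degree p. of_rat (coeff p m) * (\<alpha> ^ m * x)) = poly (map_poly of_rat p) \<alpha> * x"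
          by (simp add: poly_altdef coeff_map_poly degree_map_poly sum_distrib_right mult.assoc)
        finally show ?thesis
          using p(2) rat_linear_sum[OF insert.prems(2), of "\<lambda>_. 0" "{}"] by simp
      qed
      moreover have "poly_act \<alpha> (smult c h) g x = c * poly_act \<alpha> h g x" for c h x
        by (cases "c = 0") (simp_all add: poly_act_def sum_distrib_left mult.assoc)
      ultimately have kill: "poly_act \<alpha> (\<Prod>z\<in>?\<Lambda>. [:-z, 1:]) g = (\<lambda>x. 0)"
        using P P0 by (metis leading_coeff_0_iff mult_eq_0_iff)
      have comm: "g (\<alpha> * (a * x)) = \<eta> a * g (\<alpha> * x)" if "g \<in> U" "a \<in> A" for a x g
        using that by (simp add: U_def mult.left_commute[of \<alpha>])
      have "\<exists>G. (\<forall>l\<in>?\<Lambda>. G l \<in> U \<and> (\<forall>x. G l (\<alpha> * x) = l * G l x)) \<and> g = (\<lambda>x. \<Sum>l\<in>?\<Lambda>. G l x)"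
      proof (rule eigen_decomposition)
        show "finite ?\<Lambda>" using P0 by (rule poly_roots_finite)
        show "g \<in> U" using insert.prems by (simp add: U_def)
        show "(\<lambda>x. g (\<alpha> * x)) \<in> U" if "g \<in> U" for g
          using that comm[OF that]
          by (auto simp: U_def rat_linear_def distrib_left mult.left_commute[of \<alpha>])
      qed (use kill in \<open>auto simp: U_def rat_linear_def algebra_simps\<close>)
      then obtain G where G: "\<And>l. l \<in> ?\<Lambda> \<Longrightarrow> G l \<in> U"
        "\<And>l x. l \<in> ?\<Lambda> \<Longrightarrow> G l (\<alpha> * x) = l * G l x" and g: "g = (\<lambda>x. \<Sum>l\<in>?\<Lambda>. G l x)"
        by blast
      have "G l \<in> emb_span" if l: "l \<in> ?\<Lambda>" for l
      proof (rule insert.IH[of "insert \<alpha> A" "G l" "\<eta>(\<alpha> := l)"])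
        show "rat_linear (G l)" using G(1)[OF l] by (simp add: U_def)
        show "G l (a * x) = (\<eta>(\<alpha> := l)) a * G l x" if "a \<in> insert \<alpha> A" for a x
          using that G(1)[OF l] G(2)[OF l] False by (auto simp: U_def)
      qed (use insert.prems in auto)
      note G_span = this
      have "(\<lambda>x. \<Sum>l\<in>L. G l x) \<in> emb_span" if "L \<subseteq> ?\<Lambda>" for L
        using finite_subset[OF that poly_roots_finite[OF P0]] that
        by (induction L rule: finite_induct) (auto simp: emb_span_zero intro!: emb_span_add G_span)
      then show ?thesis unfolding g by blast
    qed
  qed
  from this[of B "{}" f] show "rat_linear f \<Longrightarrow> f \<in> emb_span"
    using finite_Basis by simp
qed

end

section \<open>Norms of algebraic integers\<close>

lemma totally_real_complex_embedding:
  assumes "totally_real TYPE('k::field_char_0)" and \<tau>: "(\<tau> :: 'k \<Rightarrow> complex) \<in> field_embeddings"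
  obtains \<sigma> where "\<sigma> \<in> real_embeddings" "\<tau> = (\<lambda>x. complex_of_real (\<sigma> x))"
proof
  have r: "of_real (Re (\<tau> x)) = \<tau> x" for x
    using assms unfolding totally_real_def by (metis of_real_Re range_subsetD)
  then show "\<tau> = (\<lambda>x. complex_of_real (Re (\<tau> x)))" by auto
  have "Im (\<tau> x) = 0" for x using r[of x] by (metis Im_complex_of_real)
  then show "(\<lambda>x. Re (\<tau> x)) \<in> real_embeddings"
    using \<tau> by (simp add: field_embeddings_def)
qed

lemma common_denominator:
  assumes "finite S"
  shows "\<exists>D>0. \<forall>s\<in>S. rat_of_nat D * s \<in> \<int>"
  using assms
proof (induction S rule: finite_induct)
  case empty
  then show ?case by (intro exI[of _ 1]) auto
next
  case (insert a S)
  then obtain D where D: "D > 0" "\<And>s. s \<in> S \<Longrightarrow> rat_of_nat D * s \<in> \<int>" by blast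
  obtain u v where uv: "a = of_int u / of_int v" "v > 0"
    by (metis Fract_of_int_quotient Rat_cases)
  have "rat_of_nat (nat v) * a = of_int u" using uv by simp
  then have "rat_of_nat (D * nat v) * a \<in> \<int>"
    by (simp add: mult.assoc)
  moreover have "rat_of_nat (D * nat v) * s \<in> \<int>" if "s \<in> S" for s
    using Ints_mult[OF Ints_of_nat[of "nat v"] D(2)[OF that]] by (simp add: mult_ac)
  ultimately show ?case using D uv by (intro exI[of _ "D * nat v"]) auto
qed

lemma det_in_Ints:
  fixes A :: "real^'n^'n"
  assumes "\<And>i j. A $ i $ j \<in> \<int>"
  shows "det A \<in> \<int>"
  unfolding det_def using assms by (auto intro!: Ints_sum Ints_mult Ints_prod)

context number_field_basis
begin

lemma coord_basis: "b \<in> B \<Longrightarrow> coord b b' = (if b' = b then 1 else 0)"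
  using representation_basis[OF independent_Basis] by simp

lemma coord_sum_distrib: "coord (sum g A) b = (\<Sum>i\<in>A. coord (g i) b)"
proof -
  have "coord 0 b = 0" using coord_add[of 0 0 b] by simp
  then show ?thesis by (induction A rule: infinite_finite_induct) (auto simp: coord_add)
qed

lemma coord_of_int: "coord (of_int c * x) b = of_int c * coord x b"
  using coord_scale[of "of_int c"] by simp

text \<open>The coordinate functional at \<open>b\<close> is a combination of embeddings. Extended
  real-linearly to the formal combination with coefficients \<open>c\<close>, it gives
  \<open>c b\<close> on one side and a combination of the vanishing sums on the other.\<close>

lemma real_embeddings_separate:
  assumes "totally_real TYPE('k)" "finite (real_embeddings :: ('k \<Rightarrow> real) set)"
    and zero: "\<And>\<sigma>. \<sigma> \<in> real_embeddings \<Longrightarrow> (\<Sum>b\<in>B. c b * \<sigma> b) = 0"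
    and b: "b \<in> B"
  shows "c b = 0"
proof -
  have fin: "finite (field_embeddings :: ('k \<Rightarrow> complex) set)"
  proof (rule finite_subset)
    show "field_embeddings \<subseteq> (\<lambda>\<sigma> (x::'k). complex_of_real (\<sigma> x)) ` real_embeddings"
      using totally_real_complex_embedding[OF assms(1)] by blast
  qed (use assms(2) in simp)
  have "rat_linear (\<lambda>x. of_rat (coord x b))"
    by (simp add: rat_linear_def coord_add coord_scale of_rat_add of_rat_mult)
  from rat_linear_in_emb_span[OF fin this] obtain k :: "('k \<Rightarrow> complex) \<Rightarrow> complex"
    where "(\<lambda>x. of_rat (coord x b)) = (\<lambda>x. \<Sum>\<tau>\<in>field_embeddings. k \<tau> * \<tau> x)"
    unfolding emb_span_def by (elim CollectE exE)
  then have k: "of_rat (coord x b) = (\<Sum>\<tau>\<in>field_embeddings. k \<tau> * \<tau> x)" for x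
    by metis
  have "of_real (c b) = (\<Sum>a\<in>B. of_real (c a) * (of_rat (coord a b) :: complex))"
    using finite_Basis b by (simp add: coord_basis if_distrib[of of_rat] if_distrib[of "\<lambda>x. _ * x"] sum.delta cong: if_cong)
  also have "\<dots> = (\<Sum>a\<in>B. \<Sum>\<tau>\<in>field_embeddings. k \<tau> * (of_real (c a) * \<tau> a))"
    by (simp only: k sum_distrib_left mult.left_commute[of "of_real _"])
  also have "\<dots> = (\<Sum>\<tau>\<in>field_embeddings. k \<tau> * (\<Sum>a\<in>B. of_real (c a) * \<tau> a))"
    by (subst sum.swap) (simp add: sum_distrib_left)
  also have "\<dots> = 0"
  proof (intro sum.neutral ballI)
    fix \<tau> :: "'k \<Rightarrow> complex" assume "\<tau> \<in> field_embeddings"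
    then obtain \<sigma> where s: "\<sigma> \<in> real_embeddings" "\<tau> = (\<lambda>x. complex_of_real (\<sigma> x))"
      using totally_real_complex_embedding[OF assms(1)] by blast
    have "(\<Sum>a\<in>B. of_real (c a) * \<tau> a) = of_real (\<Sum>a\<in>B. c a * \<sigma> a)" by (simp add: s)
    then show "k \<tau> * (\<Sum>a\<in>B. of_real (c a) * \<tau> a) = 0" using zero[OF s(1)] by simp
  qed
  finally show ?thesis by simp
qed

text \<open>
  A consequence of integrality whose closure under ring operations is immediate: \<open>(\<alpha> * \<beta>) ^ n\<close> is
  \<open>\<alpha> ^ n * \<beta> ^ n\<close>, and \<open>(\<alpha> + \<beta>) ^ n\<close> expands binomially.
\<close>

definition bounded_denom_powers :: "'k \<Rightarrow> bool" where
  "bounded_denom_powers \<alpha> \<longleftrightarrow> (\<exists>D>0. \<forall>n. \<forall>b\<in>B. rat_of_nat D * coord (\<alpha> ^ n) b \<in> \<int>)"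

text \<open>\<open>D0\<close> clears the structure constants of \<open>B\<close>, so it does not
  depend on the factors and serves all powers at once.\<close>

lemma coord_mult_denom:
  "\<exists>D0>0. \<forall>x y D D'. (\<forall>b\<in>B. rat_of_nat D * coord x b \<in> \<int>) \<longrightarrow> (\<forall>b\<in>B. rat_of_nat D' * coord y b \<in> \<int>) \<longrightarrow>
     (\<forall>b\<in>B. rat_of_nat (D * D' * D0) * coord (x * y) b \<in> \<int>)"
proof -
  have "finite ((\<lambda>(a, b, c). coord (a * b) c) ` (B \<times> B \<times> B))" using finite_Basis by simp
  from common_denominator[OF this] obtain D0 where D0: "D0 > 0"
    "\<And>a b c. a \<in> B \<Longrightarrow> b \<in> B \<Longrightarrow> c \<in> B \<Longrightarrow> rat_of_nat D0 * coord (a * b) c \<in> \<int>"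
    by fastforce
  have "rat_of_nat (D * D' * D0) * coord (x * y) c \<in> \<int>"
    if x: "\<forall>b\<in>B. rat_of_nat D * coord x b \<in> \<int>" and y: "\<forall>b\<in>B. rat_of_nat D' * coord y b \<in> \<int>"
      and c: "c \<in> B" for x y D D' c
  proof -
    have "x * y = (\<Sum>a\<in>B. \<Sum>b\<in>B. of_rat (coord x a * coord y b) * (a * b))"
      by (subst (1) coord_sum[of x, symmetric], subst (1) coord_sum[of y, symmetric])
        (simp add: sum_product of_rat_mult mult_ac)
    then have "coord (x * y) c = (\<Sum>a\<in>B. \<Sum>b\<in>B. coord x a * coord y b * coord (a * b) c)"
      by (simp only: coord_sum_distrib coord_scale)
    then have "rat_of_nat (D * D' * D0) * coord (x * y) c =
      (\<Sum>a\<in>B. \<Sum>b\<in>B. (rat_of_nat D * coord x a) * (rat_of_nat D' * coord y b) * (rat_of_nat D0 * coord (a * b) c))"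
      by (simp add: sum_distrib_left mult_ac)
    also have "\<dots> \<in> \<int>"
      using x y c D0(2) by (intro Ints_sum Ints_mult[OF Ints_mult]) blast+
    finally show ?thesis .
  qed
  then show ?thesis using D0(1) by blast
qed

lemma bounded_denom_powers_mult:
  assumes "bounded_denom_powers \<alpha>" "bounded_denom_powers \<beta>"
  shows "bounded_denom_powers (\<alpha> * \<beta>)"
proof -
  obtain D D' where "D > 0" "D' > 0"
    "\<And>n. \<forall>b\<in>B. rat_of_nat D * coord (\<alpha> ^ n) b \<in> \<int>" "\<And>n. \<forall>b\<in>B. rat_of_nat D' * coord (\<beta> ^ n) b \<in> \<int>"
    using assms unfolding bounded_denom_powers_def by metis
  moreover obtain D0 where "D0 > 0"
    "\<And>x y D D'. (\<forall>b\<in>B. rat_of_nat D * coord x b \<in> \<int>) \<Longrightarrow> (\<forall>b\<in>B. rat_of_nat D' * coord y b \<in> \<int>) \<Longrightarrow>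
     (\<forall>b\<in>B. rat_of_nat (D * D' * D0) * coord (x * y) b \<in> \<int>)"
    using coord_mult_denom by metis
  ultimately show ?thesis
    unfolding bounded_denom_powers_def power_mult_distrib
    by (intro exI[of _ "D * D' * D0"] conjI allI) simp_all
qed

lemma bounded_denom_powers_add:
  assumes "bounded_denom_powers \<alpha>" "bounded_denom_powers \<beta>"
  shows "bounded_denom_powers (\<alpha> + \<beta>)"
proof -
  obtain D D' where D: "D > 0" "D' > 0"
    "\<And>n. \<forall>b\<in>B. rat_of_nat D * coord (\<alpha> ^ n) b \<in> \<int>" "\<And>n. \<forall>b\<in>B. rat_of_nat D' * coord (\<beta> ^ n) b \<in> \<int>"
    using assms unfolding bounded_denom_powers_def by metis
  obtain D0 where D0: "D0 > 0"
    "\<And>x y D D'. (\<forall>b\<in>B. rat_of_nat D * coord x b \<in> \<int>) \<Longrightarrow> (\<forall>b\<in>B. rat_of_nat D' * coord y b \<in> \<int>) \<Longrightarrow>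
     (\<forall>b\<in>B. rat_of_nat (D * D' * D0) * coord (x * y) b \<in> \<int>)"
    using coord_mult_denom by metis
  have "rat_of_nat (D * D' * D0) * coord ((\<alpha> + \<beta>) ^ n) b \<in> \<int>" if b: "b \<in> B" for n b
  proof -
    have "(\<alpha> + \<beta>) ^ n = (\<Sum>k\<le>n. of_int (int (n choose k)) * (\<alpha> ^ k * \<beta> ^ (n - k)))"
      by (simp add: binomial_ring mult.assoc)
    then have "rat_of_nat (D * D' * D0) * coord ((\<alpha> + \<beta>) ^ n) b =
      (\<Sum>k\<le>n. of_int (int (n choose k)) * (rat_of_nat (D * D' * D0) * coord (\<alpha> ^ k * \<beta> ^ (n - k)) b))"
      by (simp only: coord_sum_distrib coord_of_int sum_distrib_left mult.left_commute[of "rat_of_nat _"])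
    also have "\<dots> \<in> \<int>"
      using D0(2)[OF D(3) D(4)] b by (intro Ints_sum Ints_mult[OF Ints_of_int]) blast
    finally show ?thesis .
  qed
  then show ?thesis unfolding bounded_denom_powers_def
    using D D0(1) by (intro exI[of _ "D * D' * D0"]) auto
qed

lemma bounded_denom_powers_minus:
  assumes "bounded_denom_powers \<alpha>"
  shows "bounded_denom_powers (- \<alpha>)"
proof -
  have "coord ((- \<alpha>) ^ n) b = of_int ((-1) ^ n) * coord (\<alpha> ^ n) b" for n b
    using coord_of_int[of "(-1) ^ n" "\<alpha> ^ n" b] by (simp add: power_minus[of \<alpha>])
  then have "rat_of_nat D * coord ((- \<alpha>) ^ n) b \<in> \<int>" if "rat_of_nat D * coord (\<alpha> ^ n) b \<in> \<int>" for D n b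
    using Ints_mult[OF Ints_of_int that, of "(-1) ^ n"] by (simp only: mult.left_commute[of "rat_of_nat _"])
  then show ?thesis
    using assms unfolding bounded_denom_powers_def by blast
qed

text \<open>The monic relation expresses \<open>\<alpha> ^ n\<close> for \<open>n \<ge> m\<close> as
  an integer combination of lower powers, so a common denominator of the first \<open>m\<close>
  powers stays valid for all.\<close>

lemma algebraic_int_bounded_denom_powers:
  assumes "algebraic_int \<alpha>"
  shows "bounded_denom_powers \<alpha>"
proof -
  obtain p where p: "poly (map_poly of_int p) \<alpha> = 0" "lead_coeff p = 1"
    using assms by (auto simp: algebraic_int_altdef_ipoly)
  define m where "m = degree p"
  have "finite ((\<lambda>(n, b). coord (\<alpha> ^ n) b) ` ({..<m} \<times> B))" using finite_Basis by simp
  from common_denominator[OF this] obtain D where D: "D > 0"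
    "\<And>n b. n < m \<Longrightarrow> b \<in> B \<Longrightarrow> rat_of_nat D * coord (\<alpha> ^ n) b \<in> \<int>"
    by fastforce
  have "(\<Sum>j\<le>m. of_int (coeff p j) * \<alpha> ^ j) = 0"
    using p(1) by (simp add: poly_altdef m_def coeff_map_poly degree_map_poly)
  then have "(\<Sum>j<m. of_int (coeff p j) * \<alpha> ^ j) + \<alpha> ^ m = 0"
    using p(2) by (simp add: m_def lessThan_Suc_atMost[symmetric])
  then have m: "\<alpha> ^ m = - (\<Sum>j<m. of_int (coeff p j) * \<alpha> ^ j)"
    by (simp add: eq_neg_iff_add_eq_0 add.commute)
  have "rat_of_nat D * coord (\<alpha> ^ n) b \<in> \<int>" if b: "b \<in> B" for n b
  proof (induction n rule: less_induct)
    case (less n)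
    show ?case
    proof (cases "n < m")
      case False
      then have "\<alpha> ^ n = \<alpha> ^ (n - m) * \<alpha> ^ m" by (simp flip: power_add)
      also have "\<dots> = (\<Sum>j<m. of_int (- coeff p j) * \<alpha> ^ (n - m + j))"
        by (simp add: m sum_distrib_left sum_negf power_add mult_ac)
      finally have "rat_of_nat D * coord (\<alpha> ^ n) b =
        (\<Sum>j<m. of_int (- coeff p j) * (rat_of_nat D * coord (\<alpha> ^ (n - m + j)) b))"
        by (simp only: coord_sum_distrib coord_of_int sum_distrib_left mult.left_commute[of "rat_of_nat _"])
      also have "\<dots> \<in> \<int>"
        using False by (intro Ints_sum Ints_mult[OF Ints_of_int] less.IH) auto
      finally show ?thesis .
    qed (use D b in auto)
  qed
  then show ?thesis unfolding bounded_denom_powers_def using D(1) by blast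
qed

end

text \<open>The conjugate vectors of \<open>B\<close> form a basis of \<open>real^'n\<close>: a
  vector orthogonal to all of them would be a linear relation between embeddings, against
  \<open>dedekind_independence\<close>, and they are independent by
  \<open>real_embeddings_separate\<close>.\<close>

lemma number_field_basis_card:
  fixes e :: "'n::finite \<Rightarrow> 'k::field_char_0 \<Rightarrow> real"
  assumes B: "number_field_basis B" and tr: "totally_real TYPE('k)"
    and e: "bij_betw e UNIV real_embeddings"
  shows "CARD('n) = card (B :: 'k set)"
proof -
  interpret K: number_field_basis B by (rule B)
  define v :: "'k \<Rightarrow> real^'n" where "v b = (\<chi> i. e i b)" for b
  have emb: "e i \<in> real_embeddings" for i using e by (auto simp: bij_betw_def)
  have fin: "finite (real_embeddings :: ('k \<Rightarrow> real) set)" using bij_betw_finite[OF e] by simp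
  have inj: "inj v"
    using field_embedding_simps(3,5)[OF emb] unfolding inj_def v_def
    by (metis (no_types, lifting) eq_iff_diff_eq_0 vec_lambda_beta)
  have sp: "span (v ` B) = UNIV"
  proof (rule ccontr)
    assume "span (v ` B) \<noteq> UNIV"
    from span_not_UNIV_orthogonal[OF this] obtain a where a: "a \<noteq> 0" "\<And>x. x \<in> span (v ` B) \<Longrightarrow> a \<bullet> x = 0"
      by blast
    have ab: "(\<Sum>i\<in>UNIV. a $ i * e i b) = 0" if "b \<in> B" for b
      using a(2)[OF span_base[OF imageI[OF that]]] by (simp add: inner_vec_def v_def)
    have "(\<Sum>i\<in>UNIV. a $ i * e i x) = 0" for x
    proof -
      have "(\<Sum>i\<in>UNIV. a $ i * e i x) = (\<Sum>i\<in>UNIV. \<Sum>b\<in>B. of_rat (K.coord x b) * (a $ i * e i b))"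
        by (subst K.coord_sum[of x, symmetric])
          (simp add: field_embedding_simps[OF emb] field_embeddingsD[OF emb] sum_distrib_left mult_ac)
      also have "\<dots> = (\<Sum>b\<in>B. of_rat (K.coord x b) * (\<Sum>i\<in>UNIV. a $ i * e i b))"
        by (subst sum.swap) (simp add: sum_distrib_left)
      finally show ?thesis using ab by simp
    qed
    then have "(\<Sum>\<sigma>\<in>real_embeddings. a $ (inv e \<sigma>) * \<sigma> x) = 0" for x
      using sum.reindex_bij_betw[OF e, of "\<lambda>\<sigma>. a $ (inv e \<sigma>) * \<sigma> x"] e
      by (simp add: bij_betw_def)
    from dedekind_independence[OF fin subset_refl this emb]
    have "a $ i = 0" for i using e by (simp add: bij_betw_def)
    then show False using a(1) by (simp add: vec_eq_iff)
  qed
  have ind: "independent (v ` B)"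
  proof (rule independent_if_scalars_zero)
    show "finite (v ` B)" using K.finite_Basis by simp
    fix f x assume f: "(\<Sum>x\<in>v ` B. f x *\<^sub>R x) = 0" and "x \<in> v ` B"
    then obtain b where b: "b \<in> B" "x = v b" by blast
    have "(\<Sum>b\<in>B. f (v b) *\<^sub>R v b) = 0"
      using f by (simp add: sum.reindex inj_on_subset[OF inj])
    then have z: "(\<Sum>b\<in>B. f (v b) * e i b) = 0" for i
      by (simp add: vec_eq_iff v_def)
    have "(\<Sum>b\<in>B. f (v b) * \<sigma> b) = 0" if "\<sigma> \<in> real_embeddings" for \<sigma>
      using z[of "inv e \<sigma>"] e that by (simp add: bij_betw_def f_inv_into_f)
    from K.real_embeddings_separate[OF tr fin this b(1)] show "f x = 0" using b by simp
  qed
  have "card (v ` B) = dim (span (v ` B))" using ind by (simp add: dim_eq_card_independent)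
  then show ?thesis using sp inj by (simp add: card_image inj_on_subset[OF inj])
qed

text \<open>
  The norm \<open>N\<close> is the determinant of the rational matrix of multiplication by \<open>\<alpha>\<close>. The powers \<open>N ^ n\<close> have
  bounded denominators, so they cannot tend to 0.
\<close>

lemma bounded_denom_powers_norm_ge_1:
  fixes e :: "'n::finite \<Rightarrow> 'k::field_char_0 \<Rightarrow> real"
  assumes B: "number_field_basis B" and tr: "totally_real TYPE('k)"
    and e: "bij_betw e UNIV real_embeddings"
    and \<alpha>: "number_field_basis.bounded_denom_powers B \<alpha>" "\<alpha> \<noteq> 0"
  shows "(\<Prod>i\<in>UNIV. \<bar>e i \<alpha>\<bar>) \<ge> 1"
proof -
  interpret K: number_field_basis B by (rule B)
  have emb: "e i \<in> real_embeddings" for i using e by (auto simp: bij_betw_def)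
  have fin: "finite (real_embeddings :: ('k \<Rightarrow> real) set)" using bij_betw_finite[OF e] by simp
  obtain b :: "'n \<Rightarrow> 'k" where b: "bij_betw b UNIV B"
    using finite_same_card_bij[of "UNIV::'n set" B] K.finite_Basis number_field_basis_card[OF B tr e] by auto
  have bB: "b j \<in> B" for j using b by (auto simp: bij_betw_def)
  define E :: "real^'n^'n" where "E = (\<chi> i j. e i (b j))"
  define M :: "'k \<Rightarrow> real^'n^'n" where "M a = (\<chi> j k. of_rat (K.coord (a * b j) (b k)))" for a
  have "invertible E"
    unfolding invertible_left_inverse matrix_left_invertible_ker
  proof (intro allI impI)
    fix x assume "E *v x = 0"
    then have z: "(\<Sum>j\<in>UNIV. e i (b j) * x $ j) = 0" for i
      by (simp add: vec_eq_iff E_def matrix_vector_mult_def)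
    have "(\<Sum>a\<in>B. x $ (inv b a) * \<sigma> a) = 0" if "\<sigma> \<in> real_embeddings" for \<sigma>
    proof -
      have "(\<Sum>j\<in>UNIV. x $ (inv b (b j)) * \<sigma> (b j)) = (\<Sum>j\<in>UNIV. e (inv e \<sigma>) (b j) * x $ j)"
        using b e that by (simp add: bij_betw_def f_inv_into_f mult.commute)
      then show ?thesis
        using sum.reindex_bij_betw[OF b, of "\<lambda>a. x $ (inv b a) * \<sigma> a"] z by simp
    qed
    from K.real_embeddings_separate[OF tr fin this bB]
    have "x $ j = 0" for j using b by (simp add: bij_betw_def)
    then show "x = 0" by (simp add: vec_eq_iff)
  qed
  then have E0: "det E \<noteq> 0" by (simp add: invertible_det_nz)
  have det: "det (M a) = (\<Prod>i\<in>UNIV. e i a)" for a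
  proof -
    let ?D = "\<chi> i j. if i = j then e i a else 0 :: real^'n^'n"
    \<comment> \<open>\<open>E\<close>, whose columns are the conjugate vectors of the basis,
      intertwines multiplication by \<open>a\<close> with the diagonal matrix of conjugates of
      \<open>a\<close>; so \<open>det (M a)\<close> is their product.\<close>
    have "?D ** E = E ** transpose (M a)"
    proof -
      have "e i a * e i (b j) = (\<Sum>k\<in>UNIV. e i (b k) * of_rat (K.coord (a * b j) (b k)))" for i j
      proof -
        have "e i a * e i (b j) = e i (\<Sum>c\<in>B. of_rat (K.coord (a * b j) c) * c)"
          by (simp add: K.coord_sum field_embeddingsD[OF emb])
        also have "\<dots> = (\<Sum>c\<in>B. e i c * of_rat (K.coord (a * b j) c))"
          by (simp add: field_embedding_simps[OF emb] field_embeddingsD[OF emb] mult.commute)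
        also have "\<dots> = (\<Sum>k\<in>UNIV. e i (b k) * of_rat (K.coord (a * b j) (b k)))"
          using sum.reindex_bij_betw[OF b, of "\<lambda>c. e i c * of_rat (K.coord (a * b j) c)"] by simp
        finally show ?thesis .
      qed
      then show ?thesis
        by (simp add: vec_eq_iff matrix_matrix_mult_def E_def M_def transpose_def
            if_distrib[of "\<lambda>x. x * _"] sum.delta cong: if_cong)
    qed
    from arg_cong[where f = det, OF this] have "det ?D * det E = det E * det (M a)"
      by (simp only: det_mul det_transpose)
    moreover have "det ?D = (\<Prod>i\<in>UNIV. e i a)" by (subst det_diagonal) auto
    ultimately show ?thesis using E0 by simp
  qed
  define N where "N = (\<Prod>i\<in>UNIV. e i \<alpha>)"
  obtain D where D: "D > 0" "\<And>n. \<forall>b\<in>B. rat_of_nat D * K.coord (\<alpha> ^ n) b \<in> \<int>"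
    using \<alpha>(1) unfolding K.bounded_denom_powers_def by auto
  obtain D0 where D0: "D0 > 0"
    "\<And>x y D D'. (\<forall>b\<in>B. rat_of_nat D * K.coord x b \<in> \<int>) \<Longrightarrow> (\<forall>b\<in>B. rat_of_nat D' * K.coord y b \<in> \<int>) \<Longrightarrow>
     (\<forall>b\<in>B. rat_of_nat (D * D' * D0) * K.coord (x * y) b \<in> \<int>)"
    using K.coord_mult_denom by metis
  define C where "C = real (D * D0)"
  \<comment> \<open>The matrices of all powers of \<alpha> share the denominator \<open>C\<close>:
    \<open>D\<close> clears \<open>\<alpha> ^ n\<close>, and \<open>D0\<close> its product with a
    basis element.\<close>
  have int: "C ^ CARD('n) * N ^ n \<in> \<int>" for n
  proof -
    have "C * M (\<alpha> ^ n) $ j $ k \<in> \<int>" for j k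
    proof -
      let ?c = "K.coord (\<alpha> ^ n * b j) (b k)"
      have "\<forall>a\<in>B. rat_of_nat 1 * K.coord (b j) a \<in> \<int>"
        by (auto simp: K.coord_basis[OF bB])
      from D0(2)[OF D(2)[of n] this] bB have "rat_of_nat (D * 1 * D0) * ?c \<in> \<int>" by blast
      then obtain m where "rat_of_nat (D * D0) * ?c = of_int m" by (auto elim: Ints_cases)
      from arg_cong[where f = real_of_rat, OF this] have "C * real_of_rat ?c = of_int m"
        by (simp add: C_def of_rat_mult)
      then show ?thesis by (simp add: M_def)
    qed
    then have "det (\<chi> j. C *s M (\<alpha> ^ n) $ j) \<in> \<int>"
      by (intro det_in_Ints) simp
    then have "C ^ CARD('n) * det (M (\<alpha> ^ n)) \<in> \<int>"
      by (simp add: det_rows_mul)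
    then show ?thesis
      by (simp add: det N_def field_embedding_simps[OF emb] prod_power_distrib)
  qed
  have C0: "C > 0" using D D0 by (simp add: C_def)
  have N0: "N \<noteq> 0" using \<alpha>(2) by (simp add: N_def field_embedding_simps[OF emb])
  have "\<bar>N\<bar> \<ge> 1"
  proof (rule ccontr)
    assume "\<not> ?thesis"
    then obtain n where n: "\<bar>N\<bar> ^ n < 1 / C ^ CARD('n)"
      using real_arch_pow_inv[of "1 / C ^ CARD('n)" "\<bar>N\<bar>"] C0 by auto
    then have "\<bar>C ^ CARD('n) * N ^ n\<bar> < 1"
      using C0 by (simp add: abs_mult power_abs field_simps)
    then show False using Ints_nonzero_abs_ge1[OF int[of n]] C0 N0 by force
  qed
  then show ?thesis by (simp add: N_def abs_prod)
qed

section \<open>Avoiding strips in the hyperplane absolute game\<close>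

text \<open>\<open>m\<close> is the least value of \<open>y\<close> at or below which half of the
  weight lies; the next smaller value, if any, misses that half by minimality.\<close>

lemma weighted_median:
  fixes w :: "'c \<Rightarrow> real" and y :: "'c \<Rightarrow> real"
  assumes "finite A" "\<And>a. a \<in> A \<Longrightarrow> w a \<ge> 0"
  shows "\<exists>m. (\<Sum>a\<in>{a\<in>A. y a < m}. w a) \<le> (\<Sum>a\<in>A. w a) / 2 \<and>
             (\<Sum>a\<in>{a\<in>A. m < y a}. w a) \<le> (\<Sum>a\<in>A. w a) / 2"
proof (cases "A = {}")
  case False
  define W where "W = (\<Sum>a\<in>A. w a)"
  have W0: "W \<ge> 0" unfolding W_def using assms by (intro sum_nonneg) auto
  define S where "S = {m \<in> y ` A. (\<Sum>a\<in>{a\<in>A. y a \<le> m}. w a) \<ge> W / 2}"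
  have fS: "finite S" using assms by (simp add: S_def)
  have "{a\<in>A. y a \<le> Max (y ` A)} = A" using assms by auto
  then have "Max (y ` A) \<in> S" using assms False W0 by (simp add: S_def W_def[symmetric])
  then have S: "Min S \<in> S" using fS by (intro Min_in) auto
  define m where "m = Min S"
  have "(\<Sum>a\<in>{a\<in>A. y a < m}. w a) \<le> W / 2"
  proof (cases "{a\<in>A. y a < m} = {}")
    case True
    show ?thesis unfolding True using W0 by simp
  next
    case False
    let ?L = "{a\<in>A. y a < m}"
    define m' where "m' = Max (y ` ?L)"
    have "m' \<in> y ` ?L" unfolding m'_def using False assms by (intro Max_in) auto
    moreover have "{a\<in>A. y a \<le> m'} = ?L"
    proof -
      have "y a \<le> m'" if "a \<in> ?L" for a
        unfolding m'_def using assms(1) that by (intro Max_ge) auto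
      then show ?thesis using calculation by auto
    qed
    moreover have "m' \<notin> S" using Min_le[OF fS, of m'] calculation by (auto simp: m_def)
    ultimately show ?thesis by (auto simp: S_def)
  qed
  moreover have "W = (\<Sum>a\<in>{a\<in>A. y a \<le> m}. w a) + (\<Sum>a\<in>{a\<in>A. m < y a}. w a)"
    unfolding W_def using assms(1) by (subst sum.union_disjoint[symmetric]) (auto intro!: sum.cong)
  then have "(\<Sum>a\<in>{a\<in>A. m < y a}. w a) \<le> W / 2" using S by (simp add: S_def m_def)
  ultimately show ?thesis unfolding W_def by blast
qed simp

lemma small_powr_factor:
  fixes c \<gamma> :: real
  assumes "c > 0" "\<gamma> > 0" "k\<^sub>1 > 0" "k\<^sub>2 > 0"
  shows "\<exists>\<epsilon>. 0 < \<epsilon> \<and> \<epsilon> \<le> c \<and> \<epsilon> powr \<gamma> * K\<^sub>1 \<le> k\<^sub>1 \<and> \<epsilon> powr \<gamma> * K\<^sub>2 \<le> k\<^sub>2"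
proof -
  \<comment> \<open>The intended value of \<open>\<epsilon> powr \<gamma>\<close>; adding 1 to the
    absolute values allows constants of any sign and 0.\<close>
  define u where "u = min (c powr \<gamma>) (min (k\<^sub>1 / (\<bar>K\<^sub>1\<bar> + 1)) (k\<^sub>2 / (\<bar>K\<^sub>2\<bar> + 1)))"
  have u: "u > 0" using assms by (simp add: u_def)
  have e: "(u powr (1 / \<gamma>)) powr \<gamma> = u" using u assms by (simp add: powr_powr)
  have "u powr (1 / \<gamma>) \<le> (c powr \<gamma>) powr (1 / \<gamma>)"
    using u assms by (intro powr_mono2) (auto simp: u_def)
  then have "u powr (1 / \<gamma>) \<le> c" using assms by (simp add: powr_powr)
  moreover have "u * K \<le> k" if "u \<le> k / (\<bar>K\<bar> + 1)" for K k
  proof -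
    have "u * K \<le> u * (\<bar>K\<bar> + 1)" using u by (intro mult_left_mono) auto
    also have "\<dots> \<le> k" using that by (simp add: field_simps)
    finally show ?thesis .
  qed
  then have "u * K\<^sub>1 \<le> k\<^sub>1" "u * K\<^sub>2 \<le> k\<^sub>2" by (auto simp: u_def)
  ultimately show ?thesis using u e by (intro exI[of _ "u powr (1 / \<gamma>)"]) auto
qed

section \<open>Balls and neighborhoods of coordinate hyperplanes\<close>

lemma affine_hyperplane_coordinate: "affine_hyperplane {x :: real^'n. x $ i = m}"
  unfolding affine_hyperplane_def
  by (intro exI[of _ "axis i 1"] exI[of _ m]) (auto simp: inner_axis' axis_eq_0_iff)

lemma norm_axis_eq: "norm (axis i t :: real^'n) = \<bar>t\<bar>"
proof -
  have "axis i t = t *\<^sub>R axis i (1::real)" by (simp add: vec_eq_iff axis_def)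
  then show ?thesis by (simp add: norm_axis_1)
qed

lemma outside_coordinate_neighborhood:
  fixes x :: "real^'n"
  assumes "x \<notin> neighborhood {x. x $ i = m} \<delta>"
  shows "\<delta> \<le> \<bar>x $ i - m\<bar>"
proof -
  have "x + axis i (m - x $ i) \<in> {x. x $ i = m}" by simp
  from infdist_le[OF this, of x] have "infdist x {x. x $ i = m} \<le> \<bar>x $ i - m\<bar>"
    by (simp add: dist_norm norm_axis_eq abs_minus_commute)
  then show ?thesis using assms by (simp add: neighborhood_def)
qed

lemma ball_on_one_side:
  fixes z :: "real^'n"
  assumes sub: "cball z \<rho> \<inter> neighborhood {x. x $ i = m} \<delta> = {}" and "\<delta> > 0" "\<rho> \<ge> 0"
  shows "(\<forall>x\<in>cball z \<rho>. x $ i \<ge> m + \<delta>) \<or> (\<forall>x\<in>cball z \<rho>. x $ i \<le> m - \<delta>)"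
proof (rule ccontr)
  assume "\<not> ?thesis"
  then obtain x y where xy: "x \<in> cball z \<rho>" "\<not> x $ i \<ge> m + \<delta>" "y \<in> cball z \<rho>" "\<not> y $ i \<le> m - \<delta>"
    by blast
  have out: "\<delta> \<le> \<bar>x $ i - m\<bar>" if "x \<in> cball z \<rho>" for x
    using outside_coordinate_neighborhood[of x i m \<delta>] that sub by blast
  have "connected ((\<lambda>x. x $ i) ` cball z \<rho>)"
    by (intro connected_continuous_image continuous_intros convex_connected convex_cball)
  moreover have "x $ i \<in> (\<lambda>x. x $ i) ` cball z \<rho>" "y $ i \<in> (\<lambda>x. x $ i) ` cball z \<rho>"
    using xy by auto
  moreover have "x $ i \<le> m" "m \<le> y $ i" using out[OF xy(1)] out[OF xy(3)] xy(2,4) \<open>\<delta> > 0\<close> by linarith+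
  ultimately have "m \<in> (\<lambda>x. x $ i) ` cball z \<rho>" by (rule connectedD_interval)
  then show False using out \<open>\<delta> > 0\<close> by force
qed

text \<open>The new ball has width \<open>2 * \<rho>'\<close> in direction \<open>i\<close> and must
  fit between the removed strip through the centre and the boundary of the old ball, within a
  distance of \<rho>.\<close>

lemma centre_move_halves_radius:
  fixes z z' :: "real^'n"
  assumes sub: "cball z' \<rho>' \<subseteq> cball z \<rho> - neighborhood {x. x $ i = z $ i} \<delta>" and "\<delta> > 0" "\<rho>' \<ge> 0"
  shows "\<rho>' \<le> \<rho> / 2"
proof -
  have c: "z' + axis i t \<in> cball z' \<rho>'" if "\<bar>t\<bar> \<le> \<rho>'" for t
    using that by (simp add: dist_norm norm_axis_eq)
  have "\<bar>(z' + axis i t) $ i - z $ i\<bar> \<le> \<rho>" if "\<bar>t\<bar> \<le> \<rho>'" for t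
  proof -
    have "z' + axis i t \<in> cball z \<rho>" using c[OF that] sub by blast
    then show ?thesis
      using component_le_norm_cart[of "z' + axis i t - z" i] by (simp add: dist_norm norm_minus_commute)
  qed
  from this[of \<rho>'] this[of "-\<rho>'"] have "\<bar>z' $ i + \<rho>' - z $ i\<bar> \<le> \<rho>" "\<bar>z' $ i - \<rho>' - z $ i\<bar> \<le> \<rho>"
    using assms(3) by simp_all
  moreover have "cball z' \<rho>' \<inter> neighborhood {x. x $ i = z $ i} \<delta> = {}" using sub by blast
  from ball_on_one_side[OF this assms(2,3)]
  have "(z' + axis i (-\<rho>')) $ i \<ge> z $ i + \<delta> \<or> (z' + axis i \<rho>') $ i \<le> z $ i - \<delta>"
  proof (elim disjE)
    assume "\<forall>x\<in>cball z' \<rho>'. z $ i + \<delta> \<le> x $ i"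
    then show ?thesis using c[of "-\<rho>'"] assms(3) by (metis abs_minus_cancel abs_of_nonneg order_refl)
  next
    assume "\<forall>x\<in>cball z' \<rho>'. x $ i \<le> z $ i - \<delta>"
    then show ?thesis using c[of "\<rho>'"] assms(3) by (metis abs_of_nonneg order_refl)
  qed
  then have "z' $ i - \<rho>' \<ge> z $ i + \<delta> \<or> z' $ i + \<rho>' \<le> z $ i - \<delta>" by simp
  ultimately show ?thesis using assms(2) by linarith
qed

text \<open>The game is separated from the arithmetic here. \<open>scale \<kappa>\<close> bounds the
  balls in which \<open>D \<epsilon> \<kappa>\<close> fits into one strip, whose position may depend
  on the ball. \<open>window_sum\<close> asks for every exponent and every window because \<beta>
  dictates both.\<close>

locale strip_family =
  fixes C :: "'c set" and D :: "real \<Rightarrow> 'c \<Rightarrow> (real^'n) set"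
    and dir :: "'c \<Rightarrow> 'n" and \<tau> scale :: "'c \<Rightarrow> real" and c :: real
  assumes c_pos: "c > 0"
    and \<tau>_pos: "\<kappa> \<in> C \<Longrightarrow> \<tau> \<kappa> > 0"
    and scale_pos: "\<kappa> \<in> C \<Longrightarrow> scale \<kappa> > 0"
    and finite_large: "0 < \<rho> \<Longrightarrow> finite {\<kappa>\<in>C. \<rho> \<le> scale \<kappa>}"
    and strip: "\<lbrakk>\<kappa> \<in> C; 0 < \<epsilon>; \<epsilon> \<le> c; 0 < \<rho>; \<rho> \<le> scale \<kappa>\<rbrakk>
      \<Longrightarrow> \<exists>y. \<forall>x\<in>D \<epsilon> \<kappa> \<inter> cball z \<rho>. \<bar>x $ dir \<kappa> - y\<bar> \<le> \<epsilon> * \<tau> \<kappa>"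
    and window_sum: "\<lbrakk>0 < \<gamma>; 0 < l; l < 1\<rbrakk>
      \<Longrightarrow> \<exists>M. \<forall>\<rho>>0. (\<Sum>\<kappa> | \<kappa> \<in> C \<and> l * \<rho> \<le> scale \<kappa> \<and> scale \<kappa> \<le> \<rho>. \<tau> \<kappa> powr \<gamma>) \<le> M * \<rho> powr \<gamma>"
begin

text \<open>Classes of smaller scale have no strip yet; they enter once the ball has shrunk to their
  scale.\<close>

definition active :: "real \<Rightarrow> real^'n \<Rightarrow> real \<Rightarrow> 'c set" where
  "active \<epsilon> z \<rho> = {\<kappa>\<in>C. \<rho> \<le> scale \<kappa> \<and> D \<epsilon> \<kappa> \<inter> cball z \<rho> \<noteq> {}}"

definition potential :: "real \<Rightarrow> real \<Rightarrow> real^'n \<Rightarrow> real \<Rightarrow> real" where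
  "potential \<gamma> \<epsilon> z \<rho> = (\<Sum>\<kappa>\<in>active \<epsilon> z \<rho>. (\<epsilon> * \<tau> \<kappa>) powr \<gamma>)"

lemma finite_active: "0 < \<rho> \<Longrightarrow> finite (active \<epsilon> z \<rho>)"
  using finite_large[of \<rho>] by (rule rev_finite_subset) (auto simp: active_def)

text \<open>
  Alice plays the weighted median of the strips in the heaviest direction. Bob's next ball lies on one side of it
  and therefore meets at most half of the weight in that direction.
\<close>

lemma potential_decreasing_move:
  assumes e: "0 < \<epsilon>" "\<epsilon> \<le> c" and \<rho>: "0 < \<rho>" and \<delta>: "0 < \<delta>"
    and thin: "\<And>\<kappa>. \<kappa> \<in> active \<epsilon> z \<rho> \<Longrightarrow> \<epsilon> * \<tau> \<kappa> \<le> \<delta> / 4"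
  shows "\<exists>i m. \<forall>z' \<rho>'. 0 < \<rho>' \<longrightarrow> cball z' \<rho>' \<subseteq> cball z \<rho> - neighborhood {x. x $ i = m} \<delta> \<longrightarrow>
    (\<Sum>\<kappa>\<in>{\<kappa>\<in>active \<epsilon> z \<rho>. D \<epsilon> \<kappa> \<inter> cball z' \<rho>' \<noteq> {}}. (\<epsilon> * \<tau> \<kappa>) powr \<gamma>)
      \<le> (1 - 1 / (2 * CARD('n))) * potential \<gamma> \<epsilon> z \<rho>"
proof -
  define A where "A = active \<epsilon> z \<rho>"
  define w where "w \<kappa> = (\<epsilon> * \<tau> \<kappa>) powr \<gamma>" for \<kappa>
  have w0: "w \<kappa> \<ge> 0" for \<kappa> by (simp add: w_def)
  have fA: "finite A" using finite_active[OF \<rho>] by (simp add: A_def)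
  have "\<exists>y. \<forall>x\<in>D \<epsilon> \<kappa> \<inter> cball z \<rho>. \<bar>x $ dir \<kappa> - y\<bar> \<le> \<delta> / 4" if "\<kappa> \<in> A" for \<kappa>
  proof -
    have "\<kappa> \<in> C" "\<rho> \<le> scale \<kappa>" using that by (auto simp: A_def active_def)
    then obtain y where "\<forall>x\<in>D \<epsilon> \<kappa> \<inter> cball z \<rho>. \<bar>x $ dir \<kappa> - y\<bar> \<le> \<epsilon> * \<tau> \<kappa>"
      using strip[OF _ e \<rho>] by blast
    then show ?thesis using thin[of \<kappa>] that unfolding A_def by (intro exI[of _ y] ballI) force
  qed
  then obtain y where y: "\<And>\<kappa> x. \<kappa> \<in> A \<Longrightarrow> x \<in> D \<epsilon> \<kappa> \<Longrightarrow> x \<in> cball z \<rho> \<Longrightarrow> \<bar>x $ dir \<kappa> - y \<kappa>\<bar> \<le> \<delta> / 4"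
    by (metis IntI)
  define W where "W i = sum w {\<kappa>\<in>A. dir \<kappa> = i}" for i
  have W: "sum w A = (\<Sum>i\<in>UNIV. W i)"
    unfolding W_def using sum.group[OF fA finite_class.finite_UNIV, of dir w] by simp
  \<comment> \<open>The heaviest direction carries at least \<open>1 / CARD('n)\<close> of the
    weight; losing half of that is the factor \<open>1 - 1 / (2 * CARD('n))\<close>.\<close>
  obtain i where "W i = Max (range W)"
    using Max_in[of "range W"] by (metis finite_class.finite_UNIV finite_imageI UNIV_not_empty image_is_empty imageE)
  then have "W j \<le> W i" for j by simp
  then have "sum w A \<le> CARD('n) * W i"
    unfolding W using sum_bounded_above[of UNIV W "W i"] by simp
  then have Wi: "W i \<ge> sum w A / CARD('n)" by (simp add: field_simps)
  obtain m where m: "(\<Sum>a\<in>{a\<in>{\<kappa>\<in>A. dir \<kappa> = i}. y a < m}. w a) \<le> W i / 2"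
             "(\<Sum>a\<in>{a\<in>{\<kappa>\<in>A. dir \<kappa> = i}. m < y a}. w a) \<le> W i / 2"
    using weighted_median[of "{\<kappa>\<in>A. dir \<kappa> = i}" w y] fA w0 unfolding W_def by auto
  have "(\<Sum>\<kappa>\<in>{\<kappa>\<in>A. D \<epsilon> \<kappa> \<inter> cball z' \<rho>' \<noteq> {}}. w \<kappa>) \<le> (1 - 1 / (2 * CARD('n))) * sum w A"
    if \<rho>': "0 < \<rho>'" and sub: "cball z' \<rho>' \<subseteq> cball z \<rho> - neighborhood {x. x $ i = m} \<delta>" for z' \<rho>'
  proof -
    let ?S = "{\<kappa>\<in>A. D \<epsilon> \<kappa> \<inter> cball z' \<rho>' \<noteq> {}}"
    have "cball z' \<rho>' \<inter> neighborhood {x. x $ i = m} \<delta> = {}" using sub by blast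
    from ball_on_one_side[OF this \<delta>]
    have side: "(\<forall>x\<in>cball z' \<rho>'. x $ i \<ge> m + \<delta>) \<or> (\<forall>x\<in>cball z' \<rho>'. x $ i \<le> m - \<delta>)"
      using \<rho>' by simp
    have near: "\<exists>x\<in>cball z' \<rho>'. \<bar>x $ i - y \<kappa>\<bar> \<le> \<delta> / 4" if "\<kappa> \<in> ?S" "dir \<kappa> = i" for \<kappa>
      using that y[of \<kappa>] sub by blast
    \<comment> \<open>Bob's ball keeps distance \<delta> from the median in direction
      \<open>i\<close>, and a strip meeting it has half-width at most \<delta>/4, so the centre of
      the strip is strictly on the same side.\<close>
    have "(\<forall>\<kappa>\<in>?S. dir \<kappa> = i \<longrightarrow> m < y \<kappa>) \<or> (\<forall>\<kappa>\<in>?S. dir \<kappa> = i \<longrightarrow> y \<kappa> < m)"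
      using side
    proof (elim disjE)
      assume s: "\<forall>x\<in>cball z' \<rho>'. x $ i \<ge> m + \<delta>"
      have "m < y \<kappa>" if k: "\<kappa> \<in> ?S" "dir \<kappa> = i" for \<kappa>
      proof -
        obtain x where x: "x \<in> cball z' \<rho>'" "\<bar>x $ i - y \<kappa>\<bar> \<le> \<delta> / 4" using near[OF k] by blast
        show ?thesis using bspec[OF s x(1)] x(2) \<delta> by linarith
      qed
      then show ?thesis by blast
    next
      assume s: "\<forall>x\<in>cball z' \<rho>'. x $ i \<le> m - \<delta>"
      have "y \<kappa> < m" if k: "\<kappa> \<in> ?S" "dir \<kappa> = i" for \<kappa>
      proof -
        obtain x where x: "x \<in> cball z' \<rho>'" "\<bar>x $ i - y \<kappa>\<bar> \<le> \<delta> / 4" using near[OF k] by blast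
        show ?thesis using bspec[OF s x(1)] x(2) \<delta> by linarith
      qed
      then show ?thesis by blast
    qed
    then have "sum w {\<kappa>\<in>?S. dir \<kappa> = i} \<le> W i / 2"
    proof (elim disjE)
      assume "\<forall>\<kappa>\<in>?S. dir \<kappa> = i \<longrightarrow> m < y \<kappa>"
      then have "sum w {\<kappa>\<in>?S. dir \<kappa> = i} \<le> (\<Sum>a\<in>{a\<in>{\<kappa>\<in>A. dir \<kappa> = i}. m < y a}. w a)"
        using fA w0 by (intro sum_mono2) auto
      then show ?thesis using m by simp
    next
      assume "\<forall>\<kappa>\<in>?S. dir \<kappa> = i \<longrightarrow> y \<kappa> < m"
      then have "sum w {\<kappa>\<in>?S. dir \<kappa> = i} \<le> (\<Sum>a\<in>{a\<in>{\<kappa>\<in>A. dir \<kappa> = i}. y a < m}. w a)"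
        using fA w0 by (intro sum_mono2) auto
      then show ?thesis using m by simp
    qed
    moreover have "sum w ?S = sum w {\<kappa>\<in>?S. dir \<kappa> = i} + sum w {\<kappa>\<in>?S. dir \<kappa> \<noteq> i}"
      using fA by (subst sum.union_disjoint[symmetric]) (auto intro!: sum.cong)
    moreover have "sum w {\<kappa>\<in>?S. dir \<kappa> \<noteq> i} \<le> sum w {\<kappa>\<in>A. dir \<kappa> \<noteq> i}"
      using fA w0 by (intro sum_mono2) auto
    moreover have "sum w A = W i + sum w {\<kappa>\<in>A. dir \<kappa> \<noteq> i}"
      unfolding W_def using fA by (subst sum.union_disjoint[symmetric]) (auto intro!: sum.cong)
    ultimately have "sum w ?S \<le> sum w A - W i / 2" by linarith
    also have "\<dots> \<le> (1 - 1 / (2 * CARD('n))) * sum w A"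
      using Wi by (simp add: algebra_simps)
    finally show ?thesis .
  qed
  then show ?thesis unfolding A_def w_def potential_def by blast
qed


theorem beta_HAW_avoiding:
  assumes \<beta>: "0 < \<beta>" "\<beta> < 1/3"
    and A: "{x. \<exists>\<epsilon>. 0 < \<epsilon> \<and> \<epsilon> \<le> c \<and> (\<forall>\<kappa>\<in>C. x \<notin> D \<epsilon> \<kappa>)} \<subseteq> A"
  shows "beta_HAW \<beta> A"
proof -
  \<comment> \<open>A median move leaves the factor \<open>1 - 1 / (2 * CARD('n))\<close>, and new
    classes may add \<open>1 / (4 * CARD('n))\<close>; \<open>q\<close> is the sum. A round of two
    turns shrinks the radius at most by \<open>\<beta>\<^sup>2\<close>, and \<gamma> solves
    \<open>(\<beta>\<^sup>2) powr \<gamma> = q\<close>. The choice of \<eta> matches the bound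
    \<delta>/4 on strips for \<open>\<delta> = \<beta> * \<rho>\<close>.\<close>
  define q where "q = 1 - 1 / (4 * real CARD('n))"
  define \<gamma> where "\<gamma> = ln q / (2 * ln \<beta>)"
  define \<eta> where "\<eta> = \<beta> / 4"
  have card1: "real CARD('n) \<ge> 1" by (simp add: Suc_le_eq)
  have q: "0 < q" "q < 1" unfolding q_def using less_le_trans[OF _ card1, of "1/4"] by (simp_all add: field_simps)
  have ln\<beta>: "ln \<beta> < 0" using \<beta> by simp
  have \<gamma>: "\<gamma> > 0" unfolding \<gamma>_def using q ln\<beta> by (intro divide_neg_neg) auto
  have \<eta>: "\<eta> > 0" using \<beta> by (simp add: \<eta>_def)
  have \<beta>\<gamma>: "(\<beta>\<^sup>2) powr \<gamma> = q"
    using \<beta> q ln\<beta> by (simp add: powr_def \<gamma>_def ln_realpow)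
  have \<beta>2: "0 < \<beta>\<^sup>2" "\<beta>\<^sup>2 < 1" using \<beta> by (auto simp: power_less_one_iff)
  obtain M where M: "\<And>\<rho>. \<rho> > 0 \<Longrightarrow>
      (\<Sum>\<kappa> | \<kappa> \<in> C \<and> \<beta>\<^sup>2 * \<rho> \<le> scale \<kappa> \<and> scale \<kappa> \<le> \<rho>. \<tau> \<kappa> powr \<gamma>) \<le> M * \<rho> powr \<gamma>"
    using window_sum[OF \<gamma> \<beta>2] by blast
  \<comment> \<open>The initial weight depends on Bob's first radius, so \<epsilon> is a function
    \<open>E\<close> of it; the strategy recovers it from the head of the history.\<close>
  define K where "K \<rho> = (\<Sum>\<kappa>\<in>{\<kappa>\<in>C. \<rho> \<le> scale \<kappa>}. \<tau> \<kappa> powr \<gamma>)" for \<rho>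
  have "\<exists>\<epsilon>. \<rho> > 0 \<longrightarrow> 0 < \<epsilon> \<and> \<epsilon> \<le> c \<and> \<epsilon> powr \<gamma> * M \<le> \<eta> powr \<gamma> / (4 * CARD('n)) \<and>
      \<epsilon> powr \<gamma> * K \<rho> \<le> (\<eta> * \<rho>) powr \<gamma>" for \<rho>
    using small_powr_factor[OF c_pos \<gamma>, of "\<eta> powr \<gamma> / (4 * CARD('n))" "(\<eta> * \<rho>) powr \<gamma>" M "K \<rho>"] \<eta>
    by (cases "\<rho> > 0") auto
  then obtain E where E: "\<And>\<rho>. \<rho> > 0 \<Longrightarrow> 0 < E \<rho>" "\<And>\<rho>. \<rho> > 0 \<Longrightarrow> E \<rho> \<le> c"
    "\<And>\<rho>. \<rho> > 0 \<Longrightarrow> E \<rho> powr \<gamma> * M \<le> \<eta> powr \<gamma> / (4 * CARD('n))"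
    "\<And>\<rho>. \<rho> > 0 \<Longrightarrow> E \<rho> powr \<gamma> * K \<rho> \<le> (\<eta> * \<rho>) powr \<gamma>"
    by metis
  define good where "good \<epsilon> z \<rho> i m \<longleftrightarrow>
     (\<forall>z' \<rho>'. 0 < \<rho>' \<longrightarrow> cball z' \<rho>' \<subseteq> cball z \<rho> - neighborhood {x. x $ i = m} (\<beta> * \<rho>) \<longrightarrow>
    (\<Sum>\<kappa>\<in>{\<kappa>\<in>active \<epsilon> z \<rho>. D \<epsilon> \<kappa> \<inter> cball z' \<rho>' \<noteq> {}}. (\<epsilon> * \<tau> \<kappa>) powr \<gamma>)
      \<le> (1 - 1 / (2 * CARD('n))) * potential \<gamma> \<epsilon> z \<rho>)" for \<epsilon> z \<rho> i m
  have "\<exists>i m. good \<epsilon> z \<rho> i m"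
    if "0 < \<epsilon>" "\<epsilon> \<le> c" "0 < \<rho>" "\<And>\<kappa>. \<kappa> \<in> active \<epsilon> z \<rho> \<Longrightarrow> \<epsilon> * \<tau> \<kappa> \<le> \<beta> * \<rho> / 4" for \<epsilon> z \<rho>
    unfolding good_def using that \<beta> by (intro potential_decreasing_move) auto
  then have good: "\<exists>p. good \<epsilon> z \<rho> (fst p) (snd p)"
    if "0 < \<epsilon>" "\<epsilon> \<le> c" "0 < \<rho>" "\<And>\<kappa>. \<kappa> \<in> active \<epsilon> z \<rho> \<Longrightarrow> \<epsilon> * \<tau> \<kappa> \<le> \<beta> * \<rho> / 4" for \<epsilon> z \<rho>
    using that by simp
  \<comment> \<open>The strategy must answer every history, also one whose strips are too thick for
    a good move; the choice is then arbitrary, but still a coordinate hyperplane and hence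
    legal.\<close>
  define I where "I \<epsilon> z \<rho> = fst (SOME p. good \<epsilon> z \<rho> (fst p) (snd p))" for \<epsilon> z \<rho>
  define N where "N \<epsilon> z \<rho> = snd (SOME p. good \<epsilon> z \<rho> (fst p) (snd p))" for \<epsilon> z \<rho>
  have IN: "(\<Sum>\<kappa>\<in>{\<kappa>\<in>active \<epsilon> z \<rho>. D \<epsilon> \<kappa> \<inter> cball z' \<rho>' \<noteq> {}}. (\<epsilon> * \<tau> \<kappa>) powr \<gamma>)
      \<le> (1 - 1 / (2 * CARD('n))) * potential \<gamma> \<epsilon> z \<rho>"
    if "0 < \<epsilon>" "\<epsilon> \<le> c" "0 < \<rho>" "\<And>\<kappa>. \<kappa> \<in> active \<epsilon> z \<rho> \<Longrightarrow> \<epsilon> * \<tau> \<kappa> \<le> \<beta> * \<rho> / 4"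
     "0 < \<rho>'" "cball z' \<rho>' \<subseteq> cball z \<rho> - neighborhood {x. x $ (I \<epsilon> z \<rho>) = N \<epsilon> z \<rho>} (\<beta> * \<rho>)"
    for \<epsilon> z \<rho> z' \<rho>'
  proof -
    have "good \<epsilon> z \<rho> (I \<epsilon> z \<rho>) (N \<epsilon> z \<rho>)"
      unfolding I_def N_def by (rule someI_ex[OF good[OF that(1-4)]])
    then show ?thesis
      unfolding good_def by (elim allE impE) (rule that(5), rule that(6), assumption)
  qed
  define j\<^sub>0 :: 'n where "j\<^sub>0 = undefined"
  \<comment> \<open>Median moves alternate with hyperplanes through the centre, which force the radii to tend to 0.\<close>
  define s :: "(real^'n) alice_strategy" where
    "s h = (let \<epsilon> = E (snd (hd h)); z = fst (last h); \<rho> = snd (last h)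
            in if odd (length h) then ({x. x $ I \<epsilon> z \<rho> = N \<epsilon> z \<rho>}, \<beta> * \<rho>)
               else ({x. x $ j\<^sub>0 = z $ j\<^sub>0}, \<beta> * \<rho>))" for h
  have "legal_strategy \<beta> s"
    using \<beta> by (auto simp: legal_strategy_def s_def Let_def affine_hyperplane_coordinate)
  moreover have "(\<Inter>i. cball (z i) (\<rho> i)) \<inter> A \<noteq> {}" if play: "bob_play \<beta> s z \<rho>" for z \<rho>
  proof -
    define \<epsilon> where "\<epsilon> = E (\<rho> 0)"
    have \<rho>0: "\<rho> 0 > 0" using play by (simp add: bob_play_def)
    note \<epsilon> = E[OF \<rho>0, folded \<epsilon>_def]
    \<comment> \<open>The history at turn \<open>i\<close> has \<open>i + 1\<close> entries, so odd
      length means an even turn.\<close>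
    have hist: "s (map (\<lambda>j. (z j, \<rho> j)) [0..<Suc i]) =
       (if even i then ({x. x $ I \<epsilon> (z i) (\<rho> i) = N \<epsilon> (z i) (\<rho> i)}, \<beta> * \<rho> i)
        else ({x. x $ j\<^sub>0 = z i $ j\<^sub>0}, \<beta> * \<rho> i))" for i
    proof -
      have "hd (map (\<lambda>j. (z j, \<rho> j)) [0..<Suc i]) = (z 0, \<rho> 0)"
        by (simp add: hd_map hd_append del: upt_Suc)
      then show ?thesis unfolding s_def Let_def \<epsilon>_def by simp
    qed
    have rad: "\<rho> (Suc i) \<ge> \<beta> * \<rho> i" for i
      using play unfolding bob_play_def by (auto simp: split_beta Let_def)
    have pos: "\<rho> i > 0" for i
    proof (induction i)
      case (Suc i)
      then show ?case using rad[of i] \<beta> by (meson less_le_trans mult_pos_pos)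
    qed (use \<rho>0 in simp)
    have sub_even: "cball (z (Suc i)) (\<rho> (Suc i)) \<subseteq> cball (z i) (\<rho> i) -
        neighborhood {x. x $ I \<epsilon> (z i) (\<rho> i) = N \<epsilon> (z i) (\<rho> i)} (\<beta> * \<rho> i)" if "even i" for i
      using play that hist[of i] unfolding bob_play_def by (metis (mono_tags, lifting) case_prod_conv)
    have sub_odd: "cball (z (Suc i)) (\<rho> (Suc i)) \<subseteq> cball (z i) (\<rho> i) -
        neighborhood {x. x $ j\<^sub>0 = z i $ j\<^sub>0} (\<beta> * \<rho> i)" if "odd i" for i
      using play that hist[of i] unfolding bob_play_def by (metis (mono_tags, lifting) case_prod_conv)
    have sub: "cball (z (Suc i)) (\<rho> (Suc i)) \<subseteq> cball (z i) (\<rho> i)" for i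
      using sub_even[of i] sub_odd[of i] by (cases "even i") auto
    have mono: "\<rho> (Suc i) \<le> \<rho> i" for i
    proof -
      have "z (Suc i) + axis j\<^sub>0 t \<in> cball (z i) (\<rho> i)" if "\<bar>t\<bar> = \<rho> (Suc i)" for t
        by (rule subsetD[OF sub[of i]]) (use that in \<open>simp add: dist_norm norm_axis_eq\<close>)
      from this[of "\<rho> (Suc i)"] this[of "- \<rho> (Suc i)"] pos[of "Suc i"]
      show ?thesis using component_le_norm_cart[of "z (Suc i) + axis j\<^sub>0 (\<rho> (Suc i)) - z i" j\<^sub>0]
          component_le_norm_cart[of "z (Suc i) + axis j\<^sub>0 (- \<rho> (Suc i)) - z i" j\<^sub>0]
        by (simp add: dist_norm norm_minus_commute)
    qed
    have half: "\<rho> (2 * Suc m) \<le> \<rho> (2 * m) / 2" for m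
      using centre_move_halves_radius[OF sub_odd[of "Suc (2 * m)"]]
        mult_pos_pos[OF \<beta>(1) pos[of "Suc (2 * m)"]] pos[of "2 * Suc m"] mono[of "2 * m"]
      by simp
    have \<beta>2\<rho>: "\<beta>\<^sup>2 * \<rho> (2 * m) \<le> \<rho> (2 * Suc m)" for m
    proof -
      have "\<beta>\<^sup>2 * \<rho> (2 * m) \<le> \<beta> * \<rho> (Suc (2 * m))"
        using mult_left_mono[OF rad[of "2 * m"], of \<beta>] \<beta> by (simp add: power2_eq_square mult.assoc)
      then show ?thesis using rad[of "Suc (2 * m)"] by simp
    qed
    define \<Phi> where "\<Phi> m = potential \<gamma> \<epsilon> (z (2 * m)) (\<rho> (2 * m))" for m
    \<comment> \<open>The bound also makes the next median move effective: every single weight is at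
      most the potential, so every active strip is thin enough.\<close>
    have invariant: "\<Phi> m \<le> (\<eta> * \<rho> (2 * m)) powr \<gamma>" for m
    proof (induction m)
      case 0
      have "\<Phi> 0 \<le> (\<Sum>\<kappa>\<in>{\<kappa>\<in>C. \<rho> 0 \<le> scale \<kappa>}. (\<epsilon> * \<tau> \<kappa>) powr \<gamma>)"
        unfolding \<Phi>_def potential_def by (intro sum_mono2) (use finite_large[OF \<rho>0] in \<open>auto simp: active_def\<close>)
      also have "\<dots> = \<epsilon> powr \<gamma> * K (\<rho> 0)"
        using \<epsilon>(1) \<tau>_pos unfolding K_def sum_distrib_left
        by (intro sum.cong) (auto simp: powr_mult less_imp_le)
      also have "\<dots> \<le> (\<eta> * \<rho> 0) powr \<gamma>" by (rule \<epsilon>(4))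
      finally show ?case by simp
    next
      case (Suc m)
      let ?B = "active \<epsilon> (z (2 * m)) (\<rho> (2 * m))" and ?B' = "active \<epsilon> (z (2 * Suc m)) (\<rho> (2 * Suc m))"
      let ?old = "{\<kappa>\<in>?B. D \<epsilon> \<kappa> \<inter> cball (z (Suc (2 * m))) (\<rho> (Suc (2 * m))) \<noteq> {}}"
      let ?new = "{\<kappa>. \<kappa> \<in> C \<and> \<beta>\<^sup>2 * \<rho> (2 * m) \<le> scale \<kappa> \<and> scale \<kappa> \<le> \<rho> (2 * m)}"
      let ?w = "\<lambda>\<kappa>. (\<epsilon> * \<tau> \<kappa>) powr \<gamma>"
      have fold: "finite ?old" using finite_active[OF pos] by simp
      have fnew: "finite ?new"
        by (rule finite_subset[OF _ finite_large[of "\<beta>\<^sup>2 * \<rho> (2 * m)"]]) (use \<beta> pos[of "2 * m"] in auto)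
      have thin: "\<epsilon> * \<tau> \<kappa> \<le> \<beta> * \<rho> (2 * m) / 4" if k: "\<kappa> \<in> ?B" for \<kappa>
      proof (rule ccontr)
        assume "\<not> ?thesis"
        then have "(\<eta> * \<rho> (2 * m)) powr \<gamma> < ?w \<kappa>"
          using \<gamma> \<eta> pos[of "2 * m"] by (intro powr_less_mono2) (auto simp: \<eta>_def)
        also have "?w \<kappa> \<le> \<Phi> m"
          unfolding \<Phi>_def potential_def using finite_active[OF pos] k by (intro member_le_sum) auto
        finally show False using Suc by simp
      qed
      \<comment> \<open>A class active after the round either was active before and still meets the
        ball left by the median move, or has its scale in the window that the radius can cross in
        one round.\<close>
      have "?B' \<subseteq> ?old \<union> ?new"
      proof
        fix \<kappa> assume k: "\<kappa> \<in> ?B'"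
        show "\<kappa> \<in> ?old \<union> ?new"
        proof (cases "scale \<kappa> \<le> \<rho> (2 * m)")
          case True
          then show ?thesis using k \<beta>2\<rho>[of m] by (auto simp: active_def)
        next
          case False
          have "cball (z (2 * Suc m)) (\<rho> (2 * Suc m)) \<subseteq> cball (z (Suc (2 * m))) (\<rho> (Suc (2 * m)))"
            using sub[of "Suc (2 * m)"] by simp
          then show ?thesis using False k sub[of "2 * m"] unfolding active_def by fastforce
        qed
      qed
      then have "\<Phi> (Suc m) \<le> sum ?w (?old \<union> ?new)"
        unfolding \<Phi>_def potential_def using fold fnew by (intro sum_mono2) auto
      also have "\<dots> \<le> sum ?w ?old + sum ?w ?new"
        using fold fnew by (subst sum_Un) (auto intro!: sum_nonneg)
      also have "sum ?w ?old \<le> (1 - 1 / (2 * CARD('n))) * \<Phi> m"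
        unfolding \<Phi>_def by (rule IN[OF \<epsilon>(1,2) pos thin pos sub_even]) auto
      also have "(1 - 1 / (2 * CARD('n))) * \<Phi> m \<le> (1 - 1 / (2 * CARD('n))) * (\<eta> * \<rho> (2 * m)) powr \<gamma>"
        using Suc order.trans[OF _ card1, of "1/2"] by (intro mult_left_mono) (auto simp: field_simps)
      also have "sum ?w ?new = \<epsilon> powr \<gamma> * (\<Sum>\<kappa>\<in>?new. \<tau> \<kappa> powr \<gamma>)"
        using \<epsilon>(1) \<tau>_pos unfolding sum_distrib_left
        by (intro sum.cong) (auto simp: powr_mult less_imp_le)
      also have "\<dots> \<le> \<epsilon> powr \<gamma> * (M * \<rho> (2 * m) powr \<gamma>)"
        using M[OF pos[of "2 * m"]] by (intro mult_left_mono) auto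
      also have "\<dots> = \<epsilon> powr \<gamma> * M * \<rho> (2 * m) powr \<gamma>" by simp
      also have "\<dots> \<le> \<eta> powr \<gamma> / (4 * CARD('n)) * \<rho> (2 * m) powr \<gamma>"
        using \<epsilon>(3) by (intro mult_right_mono) auto
      also have "\<eta> powr \<gamma> / (4 * CARD('n)) * \<rho> (2 * m) powr \<gamma> = 1 / (4 * CARD('n)) * (\<eta> * \<rho> (2 * m)) powr \<gamma>"
        using \<eta> pos[of "2 * m"] by (simp add: powr_mult)
      also have "(1 - 1 / (2 * CARD('n))) * (\<eta> * \<rho> (2 * m)) powr \<gamma> + \<dots> = q * (\<eta> * \<rho> (2 * m)) powr \<gamma>"
        using card1 by (simp add: q_def field_simps)
      also have "\<dots> = (\<beta>\<^sup>2 * (\<eta> * \<rho> (2 * m))) powr \<gamma>"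
        using \<beta>\<gamma> \<beta>2 \<eta> pos[of "2 * m"] by (simp add: powr_mult)
      also have "\<dots> \<le> (\<eta> * \<rho> (2 * Suc m)) powr \<gamma>"
        using \<gamma> \<eta> \<beta>2 \<beta>2\<rho>[of m] pos[of "2 * m"] by (intro powr_mono2) (auto simp: mult.left_commute[of "\<beta>\<^sup>2"])
      finally show ?case by simp
    qed
    have "(\<Inter>i. cball (z i) (\<rho> i)) \<noteq> {}"
    proof (rule compact_nest)
      show "cball (z n) (\<rho> n) \<subseteq> cball (z m) (\<rho> m)" if "m \<le> n" for m n
        using lift_Suc_antimono_le[of "\<lambda>i. cball (z i) (\<rho> i)", OF _ that] sub by blast
    qed (simp_all add: pos[THEN less_not_sym])
    then obtain x where x: "\<And>i. x \<in> cball (z i) (\<rho> i)" by blast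
    have geo: "\<rho> (2 * m) \<le> \<rho> 0 * (1/2) ^ m" for m
    proof (induction m)
      case (Suc m)
      then show ?case using half[of m] by simp
    qed simp
    have "x \<notin> D \<epsilon> \<kappa>" if k: "\<kappa> \<in> C" for \<kappa>
    proof
      assume xD: "x \<in> D \<epsilon> \<kappa>"
      \<comment> \<open>Below radius \<open>u\<close> the class would be active, and its fixed
        weight would exceed the bound on the potential.\<close>
      define u where "u = min (scale \<kappa>) (\<epsilon> * \<tau> \<kappa> / \<eta>)"
      have "u > 0" using \<tau>_pos[OF k] scale_pos[OF k] \<epsilon>(1) \<eta> by (simp add: u_def)
      then obtain m where "(1/2) ^ m < u / \<rho> 0"
        using real_arch_pow_inv[of "u / \<rho> 0" "1/2"] \<rho>0 by auto
      then have "\<rho> 0 * (1/2) ^ m < u" using \<rho>0 by (simp add: field_simps)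
      then have m: "\<rho> (2 * m) < u" using geo[of m] by linarith
      then have "\<kappa> \<in> active \<epsilon> (z (2 * m)) (\<rho> (2 * m))"
        using k xD x[of "2 * m"] by (auto simp: active_def u_def)
      then have "(\<epsilon> * \<tau> \<kappa>) powr \<gamma> \<le> \<Phi> m"
        unfolding \<Phi>_def potential_def using finite_active[OF pos] by (intro member_le_sum) auto
      also have "\<dots> \<le> (\<eta> * \<rho> (2 * m)) powr \<gamma>" by (rule invariant)
      also have "\<dots> < (\<epsilon> * \<tau> \<kappa>) powr \<gamma>"
        using m \<eta> \<gamma> pos[of "2 * m"] by (intro powr_less_mono2) (auto simp: u_def field_simps)
      finally show False by simp
    qed
    then have "x \<in> A" using A \<epsilon>(1,2) by blast
    then show ?thesis using x by blast
  qed
  ultimately show ?thesis unfolding beta_HAW_def by blast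
qed

end

section \<open>Classes of fractions\<close>

lemma card_nat_interval_le:
  fixes S :: "nat set"
  assumes "finite S" "\<And>n. n \<in> S \<Longrightarrow> u \<le> real n \<and> real n \<le> u + v" "v \<ge> 0"
  shows "real (card S) \<le> v + 1"
proof (cases "S = {}")
  case False
  have "S \<subseteq> {Min S..Max S}" using assms(1) by auto
  then have "card S \<le> Suc (Max S) - Min S" using card_mono[of "{Min S..Max S}" S] by simp
  moreover have "Min S \<le> Max S" "Min S \<in> S" "Max S \<in> S" using assms(1) False by auto
  ultimately show ?thesis using assms(2)[of "Min S"] assms(2)[of "Max S"] by linarith
qed (use assms in simp)

lemma ln_le_if_le_exp: "0 < x \<Longrightarrow> x \<le> exp y \<Longrightarrow> ln x \<le> (y::real)"
  by (metis exp_le_cancel_iff exp_ln)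

text \<open>Over a box of indices containing \<open>F\<close> the sum factors into one geometric
  series per coordinate.\<close>

lemma sum_exp_multiindex_le:
  fixes F :: "('n::finite \<Rightarrow> nat) set"
  assumes "finite F" "a > 0"
  shows "(\<Sum>k\<in>F. exp (- a * real (\<Sum>i\<in>UNIV. k i))) \<le> (1 / (1 - exp (- a))) ^ CARD('n)"
proof -
  define N where "N = Max (insert 0 ((\<lambda>k. \<Sum>i\<in>UNIV. k i) ` F))"
  have "k i \<le> N" if "k \<in> F" for k i
  proof -
    have "k i \<le> (\<Sum>i\<in>UNIV. k i)" by (rule member_le_sum) auto
    also have "\<dots> \<le> N" unfolding N_def using assms(1) that by (intro Max_ge) auto
    finally show ?thesis .
  qed
  then have sub: "F \<subseteq> PiE (UNIV::'n set) (\<lambda>_. {..N})" by auto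
  have "(\<Sum>k\<in>F. exp (- a * real (\<Sum>i\<in>UNIV. k i))) \<le> (\<Sum>k\<in>PiE (UNIV::'n set) (\<lambda>_. {..N}). exp (- a * real (\<Sum>i\<in>UNIV. k i)))"
    using sub by (intro sum_mono2) (auto intro!: finite_PiE)
  also have "\<dots> = (\<Sum>k\<in>PiE (UNIV::'n set) (\<lambda>_. {..N}). \<Prod>i\<in>(UNIV::'n set). exp (- a) ^ k i)"
    by (intro sum.cong refl) (simp add: exp_sum[symmetric] sum_distrib_left exp_of_nat_mult[symmetric] mult.commute sum_negf)
  also have "\<dots> = (\<Prod>i\<in>(UNIV::'n set). \<Sum>j\<le>N. exp (- a) ^ j)"
    by (rule prod_sum_PiE[symmetric]) auto
  also have "\<dots> \<le> (\<Prod>i\<in>(UNIV::'n set). 1 / (1 - exp (- a)))"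
  proof (intro prod_mono conjI)
    have x: "0 < exp (- a)" "exp (- a) < 1" using assms(2) by auto
    have "(\<Sum>j\<le>N. exp (- a) ^ j) \<le> (\<Sum>j. exp (- a) ^ j)"
      using x by (intro sum_le_suminf) (auto intro!: summable_geometric)
    then show "(\<Sum>j\<le>N. exp (- a) ^ j) \<le> 1 / (1 - exp (- a))"
      using x by (simp add: suminf_geometric)
  qed (auto intro!: sum_nonneg)
  finally show ?thesis by simp
qed

text \<open>This is what the counting of fractions uses of the number field. The bound for
  \<open>p * q' - p' * q\<close> is stated separately because in the application it comes from the
  bounded denominators of the powers of that element.\<close>

locale weighted_embeddings =
  fixes e :: "'n::finite \<Rightarrow> 'k::field_char_0 \<Rightarrow> real" and w :: "'n \<Rightarrow> real"
  assumes e_one: "e i 1 = 1" and e_add: "e i (x + y) = e i x + e i y" and e_mult: "e i (x * y) = e i x * e i y"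
    and w_nonneg: "w i \<ge> 0" and w_sum: "(\<Sum>i\<in>UNIV. w i) = 1"
    and norm_ge_1: "\<lbrakk>algebraic_int q; q \<noteq> 0\<rbrakk> \<Longrightarrow> (\<Prod>i\<in>UNIV. \<bar>e i q\<bar>) \<ge> 1"
    and det_norm_ge_1: "\<lbrakk>algebraic_int p; algebraic_int q; algebraic_int p'; algebraic_int q'; p * q' \<noteq> p' * q\<rbrakk>
      \<Longrightarrow> (\<Prod>i\<in>UNIV. \<bar>e i (p * q' - p' * q)\<bar>) \<ge> 1"
begin

lemma e_diff: "e i (x - y) = e i x - e i y"
  using e_add[of i "x - y" y] by simp

lemma e_nonzero: "x \<noteq> 0 \<Longrightarrow> e i x \<noteq> 0"
  using e_mult[of i x "inverse x"] e_one[of i] by auto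

definition total :: "('n \<Rightarrow> nat) \<Rightarrow> nat" where
  "total k = (\<Sum>i\<in>UNIV. k i)"

text \<open>
  A class is a pair \<open>(T, k)\<close>: \<open>T\<close> is the logarithm of the weighted norm of the denominator \<open>q\<close>, rounded up, and
  \<open>k i\<close> measures by how much \<open>\<bar>e i q\<bar>\<close> falls short of \<open>exp (w i * T)\<close>. Up to a factor depending only on \<open>\<epsilon>\<close>,
  the points that a fraction of the class approximates too well form a box of side \<open>exp (- level (T, k) i)\<close> in direction \<open>i\<close>.
\<close>

definition level :: "nat \<times> ('n \<Rightarrow> nat) \<Rightarrow> 'n \<Rightarrow> real" where
  "level \<kappa> i = 2 * w i * real (fst \<kappa>) - real (snd \<kappa> i)"

definition top_level :: "nat \<times> ('n \<Rightarrow> nat) \<Rightarrow> real" where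
  "top_level \<kappa> = Max (range (level \<kappa>))"

definition thin_dir :: "nat \<times> ('n \<Rightarrow> nat) \<Rightarrow> 'n" where
  "thin_dir \<kappa> = (SOME i. level \<kappa> i = top_level \<kappa>)"

text \<open>The factor \<open>exp 1\<close> pays for \<open>\<bar>e i q\<bar>\<close> being known
  only up to that factor within a class.\<close>

definition thickness :: "nat \<times> ('n \<Rightarrow> nat) \<Rightarrow> real" where
  "thickness \<kappa> = exp (1 - top_level \<kappa>)"

text \<open>
  In a ball whose radius is at most the scale of a class, all fractions of that class coincide: the norm estimate
  in \<open>near_fraction_unique\<close> has a surplus of \<open>exp (- total k)\<close>, which leaves room for a factor of up to
  \<open>exp (total k / CARD('n))\<close> here. That factor makes the thickness of a class much smaller than its scale, so that
  the weights are summable. Only its square root is used, to keep finite the set of classes above a given scale.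
\<close>

definition size_scale :: "nat \<times> ('n \<Rightarrow> nat) \<Rightarrow> real" where
  "size_scale \<kappa> = exp (real (total (snd \<kappa>)) / (2 * CARD('n)) - top_level \<kappa>) / 8"

text \<open>As the weights sum to 1, a denominator in \<open>(T, k)\<close> has norm at most
  \<open>exp (T - total k)\<close>; the norm being at least 1, no other pairs occur.\<close>

definition classes :: "(nat \<times> ('n \<Rightarrow> nat)) set" where
  "classes = {\<kappa>. total (snd \<kappa>) \<le> fst \<kappa>}"

text \<open>For \<open>w i = 0\<close> the conditions force \<open>\<bar>e i q\<bar> \<le> 1\<close>
  and an error of at most \<epsilon>, so embeddings of weight 0 are covered by the same
  formula.\<close>

definition near_fraction :: "real \<Rightarrow> nat \<times> ('n \<Rightarrow> nat) \<Rightarrow> 'k \<Rightarrow> 'k \<Rightarrow> real^'n \<Rightarrow> bool" where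
  "near_fraction \<epsilon> \<kappa> p q x \<longleftrightarrow> algebraic_int p \<and> algebraic_int q \<and> q \<noteq> 0 \<and>
     (\<forall>i. exp (w i * real (fst \<kappa>) - real (snd \<kappa> i) - 1) < \<bar>e i q\<bar> \<and>
          \<bar>e i q\<bar> \<le> exp (w i * real (fst \<kappa>) - real (snd \<kappa> i)) \<and>
          \<bar>e i q * x $ i + e i p\<bar> \<le> \<epsilon> * exp (- w i * real (fst \<kappa>)))"

definition danger :: "real \<Rightarrow> nat \<times> ('n \<Rightarrow> nat) \<Rightarrow> (real^'n) set" where
  "danger \<epsilon> \<kappa> = {x. \<exists>p q. near_fraction \<epsilon> \<kappa> p q x}"

lemma level_le_top: "level \<kappa> i \<le> top_level \<kappa>"
  unfolding top_level_def by (intro Max_ge) auto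

lemma level_thin_dir: "level \<kappa> (thin_dir \<kappa>) = top_level \<kappa>"
proof -
  have "top_level \<kappa> \<in> range (level \<kappa>)" unfolding top_level_def by (intro Max_in) auto
  then obtain i where "level \<kappa> i = top_level \<kappa>" by auto
  then show ?thesis unfolding thin_dir_def by (rule someI)
qed

lemma near_fraction_unique:
  assumes \<epsilon>: "\<epsilon> \<le> 1/8" and \<rho>: "\<rho> \<le> size_scale \<kappa>"
    and x: "near_fraction \<epsilon> \<kappa> p q x" and x': "near_fraction \<epsilon> \<kappa> p' q' x'"
    and ball: "x \<in> cball z \<rho>" "x' \<in> cball z \<rho>"
  shows "p * q' = p' * q"
proof (rule ccontr)
  assume ne: "p * q' \<noteq> p' * q"
  define T where "T = real (fst \<kappa>)"
  define k where "k i = real (snd \<kappa> i)" for i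
  define K where "K = real (total (snd \<kappa>))"
  note nf = x[unfolded near_fraction_def] x'[unfolded near_fraction_def]
  \<comment> \<open>The constants 1/8 for \<epsilon> and in \<open>size_scale\<close> make each of
    the two kinds of error at most a quarter of \<open>exp (K / (2 * CARD('n)) - k i)\<close>. In
    the product over \<open>i\<close> the surplus is \<open>exp (K / 2)\<close>, against the gain
    \<open>exp (- K)\<close>.\<close>
  have bound: "\<bar>e i (p * q' - p' * q)\<bar> \<le> exp (K / (2 * CARD('n)) - k i) / 2" for i
  proof -
    have q: "\<bar>e i q\<bar> \<le> exp (w i * T - k i)" "\<bar>e i q'\<bar> \<le> exp (w i * T - k i)"
      and a: "\<bar>e i q * x $ i + e i p\<bar> \<le> \<epsilon> * exp (- w i * T)" "\<bar>e i q' * x' $ i + e i p'\<bar> \<le> \<epsilon> * exp (- w i * T)"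
      using nf unfolding T_def k_def by auto
    have dx: "\<bar>x' $ i - x $ i\<bar> \<le> 2 * \<rho>"
    proof -
      have "\<bar>x' $ i - x $ i\<bar> \<le> dist x' x"
        using component_le_norm_cart[of "x' - x" i] by (simp add: dist_norm)
      also have "\<dots> \<le> 2 * \<rho>" using ball dist_triangle[of x' x z] by (simp add: dist_commute)
      finally show ?thesis .
    qed
    \<comment> \<open>The two fractions are tested at different points; the last term accounts for
      this and is controlled by the diameter of the ball.\<close>
    have "e i (p * q' - p' * q) = (e i q * x $ i + e i p) * e i q' - (e i q' * x' $ i + e i p') * e i q
        + e i q * e i q' * (x' $ i - x $ i)"
      by (simp add: e_diff e_mult algebra_simps)
    then have "\<bar>e i (p * q' - p' * q)\<bar> \<le> \<bar>e i q * x $ i + e i p\<bar> * \<bar>e i q'\<bar> + \<bar>e i q' * x' $ i + e i p'\<bar> * \<bar>e i q\<bar>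
        + \<bar>e i q\<bar> * \<bar>e i q'\<bar> * \<bar>x' $ i - x $ i\<bar>"
      unfolding abs_mult[symmetric] by linarith
    also have "\<dots> \<le> (\<epsilon> * exp (- w i * T)) * exp (w i * T - k i) + (\<epsilon> * exp (- w i * T)) * exp (w i * T - k i)
        + exp (w i * T - k i) * exp (w i * T - k i) * (2 * \<rho>)"
      using a q dx order.trans[OF abs_ge_zero a(1)] by (intro add_mono mult_mono) auto
    also have "\<dots> = exp (- k i) * (2 * \<epsilon> + 2 * \<rho> * exp (2 * w i * T - k i))"
    proof -
      have 1: "exp (- w i * T) * exp (w i * T - k i) = exp (- k i)" by (simp only: mult_exp_exp) simp
      have 2: "exp (w i * T - k i) * exp (w i * T - k i) = exp (- k i) * exp (2 * w i * T - k i)"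
        by (simp only: mult_exp_exp) simp
      show ?thesis unfolding mult.assoc[of \<epsilon>] 1 2 by (simp add: algebra_simps)
    qed
    also have "\<dots> \<le> exp (- k i) * (1/4 + 2 * (exp (K / (2 * CARD('n)) - top_level \<kappa>) / 8) * exp (top_level \<kappa>))"
    proof -
      have "2 * w i * T - k i \<le> top_level \<kappa>"
        using level_le_top[of \<kappa> i] by (simp add: level_def T_def k_def)
      moreover have "0 \<le> \<rho>" using ball(1) by (meson mem_cball order.trans zero_le_dist)
      ultimately have "2 * \<rho> * exp (2 * w i * T - k i) \<le> 2 * size_scale \<kappa> * exp (top_level \<kappa>)"
        using \<rho> by (intro mult_mono) auto
      then show ?thesis using \<epsilon> by (simp add: size_scale_def K_def)
    qed
    also have "\<dots> = exp (- k i) * (1/4 + exp (K / (2 * CARD('n))) / 4)"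
      by (simp add: mult_exp_exp)
    also have "\<dots> \<le> exp (- k i) * (exp (K / (2 * CARD('n))) / 4 + exp (K / (2 * CARD('n))) / 4)"
      by (intro mult_left_mono add_right_mono) (auto simp: K_def)
    finally show ?thesis by (simp add: mult_exp_exp)
  qed
  have "1 \<le> (\<Prod>i\<in>UNIV. \<bar>e i (p * q' - p' * q)\<bar>)"
    using nf ne by (intro det_norm_ge_1) auto
  also have "\<dots> \<le> (\<Prod>i\<in>UNIV. exp (K / (2 * CARD('n)) - k i) / 2)"
    by (intro prod_mono) (use bound in auto)
  also have "\<dots> = exp (\<Sum>i\<in>UNIV. K / (2 * CARD('n)) - k i) / 2 ^ CARD('n)"
    by (simp add: prod_dividef exp_sum)
  also have "(\<Sum>i\<in>UNIV. K / (2 * CARD('n)) - k i) = - K / 2"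
    by (simp add: sum_subtractf K_def k_def total_def)
  also have "exp (- K / 2) / 2 ^ CARD('n) \<le> 1 / 2 ^ CARD('n)"
    by (intro divide_right_mono) (auto simp: K_def)
  also have "\<dots> < 1" by (simp add: one_less_power)
  finally show False by simp
qed

text \<open>In the ball all fractions of the class coincide, and their common value is the centre of
  the strip. In the direction of the top level, dividing the error by
  \<open>\<bar>e i q\<bar>\<close> yields the thickness.\<close>

lemma danger_in_strip:
  assumes \<epsilon>: "\<epsilon> \<le> 1/8" and \<rho>: "\<rho> \<le> size_scale \<kappa>"
  shows "\<exists>y. \<forall>x\<in>danger \<epsilon> \<kappa> \<inter> cball z \<rho>. \<bar>x $ thin_dir \<kappa> - y\<bar> \<le> \<epsilon> * thickness \<kappa>"
proof (cases "danger \<epsilon> \<kappa> \<inter> cball z \<rho> = {}")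
  case False
  then obtain x\<^sub>0 p\<^sub>0 q\<^sub>0 where x0: "near_fraction \<epsilon> \<kappa> p\<^sub>0 q\<^sub>0 x\<^sub>0" "x\<^sub>0 \<in> cball z \<rho>"
    by (auto simp: danger_def)
  let ?j = "thin_dir \<kappa>"
  have "\<bar>x $ ?j - (- e ?j p\<^sub>0 / e ?j q\<^sub>0)\<bar> \<le> \<epsilon> * thickness \<kappa>" if xd: "x \<in> danger \<epsilon> \<kappa>" "x \<in> cball z \<rho>" for x
  proof -
    obtain p q where pq: "near_fraction \<epsilon> \<kappa> p q x" using xd by (auto simp: danger_def)
    from near_fraction_unique[OF \<epsilon> \<rho> pq x0(1) xd(2) x0(2)] have "e ?j p * e ?j q\<^sub>0 = e ?j p\<^sub>0 * e ?j q"
      by (metis e_mult)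
    moreover have nz: "e ?j q \<noteq> 0" "e ?j q\<^sub>0 \<noteq> 0"
      using pq x0(1) e_nonzero by (auto simp: near_fraction_def)
    ultimately have "x $ ?j - (- e ?j p\<^sub>0 / e ?j q\<^sub>0) = (e ?j q * x $ ?j + e ?j p) / e ?j q"
      by (simp add: field_simps)
    then have "\<bar>x $ ?j - (- e ?j p\<^sub>0 / e ?j q\<^sub>0)\<bar> = \<bar>e ?j q * x $ ?j + e ?j p\<bar> / \<bar>e ?j q\<bar>"
      by simp
    also have "\<dots> \<le> (\<epsilon> * exp (- w ?j * real (fst \<kappa>))) / exp (w ?j * real (fst \<kappa>) - real (snd \<kappa> ?j) - 1)"
    proof (rule frac_le)
      show a: "\<bar>e ?j q * x $ ?j + e ?j p\<bar> \<le> \<epsilon> * exp (- w ?j * real (fst \<kappa>))"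
        using pq by (simp add: near_fraction_def)
      show "0 \<le> \<epsilon> * exp (- w ?j * real (fst \<kappa>))" by (rule order.trans[OF abs_ge_zero a])
      show "exp (w ?j * real (fst \<kappa>) - real (snd \<kappa> ?j) - 1) \<le> \<bar>e ?j q\<bar>"
        using pq by (simp add: near_fraction_def less_imp_le)
    qed simp
    also have "\<dots> = \<epsilon> * (exp (- w ?j * real (fst \<kappa>)) / exp (w ?j * real (fst \<kappa>) - real (snd \<kappa> ?j) - 1))"
      by simp
    also have "\<dots> = \<epsilon> * exp (1 - level \<kappa> ?j)"
      unfolding exp_diff[symmetric] by (simp add: level_def algebra_simps)
    also have "\<dots> = \<epsilon> * thickness \<kappa>" by (simp add: level_thin_dir thickness_def)
    finally show ?thesis .
  qed
  then show ?thesis by blast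
qed auto

text \<open>The levels sum to \<open>2 * T - K\<close> with \<open>K = total k\<close>, so the top
  level is at least \<open>(2 * T - K) / CARD('n)\<close>, and a scale of at least \<rho> bounds
  \<open>2 * T - 3 * K / 2\<close> from above. As \<open>K \<le> T\<close>, this bounds
  \<open>T\<close>; with \<open>exp (K / CARD('n))\<close> in the scale, only
  \<open>2 * T - 2 * K\<close> would be bounded.\<close>

lemma finite_large_classes:
  assumes "0 < \<rho>"
  shows "finite {\<kappa>\<in>classes. \<rho> \<le> size_scale \<kappa>}"
proof -
  define N where "N = nat \<lceil>- 2 * CARD('n) * ln (8 * \<rho>)\<rceil>"
  have "fst \<kappa> \<le> N \<and> (\<forall>i. snd \<kappa> i \<le> N)" if k: "\<kappa> \<in> classes" "\<rho> \<le> size_scale \<kappa>" for \<kappa>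
  proof -
    let ?T = "real (fst \<kappa>)" and ?K = "real (total (snd \<kappa>))" and ?d = "real CARD('n)"
    have "8 * \<rho> \<le> exp (?K / (2 * ?d) - top_level \<kappa>)" using k(2) by (simp add: size_scale_def)
    then have 1: "ln (8 * \<rho>) \<le> ?K / (2 * ?d) - top_level \<kappa>" using assms by (intro ln_le_if_le_exp) auto
    have "(\<Sum>i\<in>UNIV. level \<kappa> i) = 2 * ?T - ?K"
      by (simp add: level_def sum_subtractf total_def sum_distrib_right[symmetric] sum_distrib_left[symmetric] w_sum)
    moreover have "(\<Sum>i\<in>UNIV. level \<kappa> i) \<le> ?d * top_level \<kappa>"
      using sum_bounded_above[of UNIV "level \<kappa>" "top_level \<kappa>"] level_le_top by simp
    ultimately have "2 * ?T - ?K \<le> ?d * top_level \<kappa>" by simp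
    also have "\<dots> \<le> ?d * (?K / (2 * ?d) - ln (8 * \<rho>))"
      using 1 by (intro mult_left_mono) auto
    also have "\<dots> = ?K / 2 - ?d * ln (8 * \<rho>)" by (simp add: right_diff_distrib)
    finally have 2: "2 * ?T - ?K \<le> ?K / 2 - ?d * ln (8 * \<rho>)" .
    have K: "total (snd \<kappa>) \<le> fst \<kappa>" using k(1) by (simp add: classes_def)
    then have "?T \<le> - 2 * ?d * ln (8 * \<rho>)" using 2 by linarith
    then have T: "fst \<kappa> \<le> N" unfolding N_def by linarith
    have "snd \<kappa> i \<le> total (snd \<kappa>)" for i unfolding total_def by (rule member_le_sum) auto
    then show ?thesis using T K by (meson order.trans)
  qed
  then have "{\<kappa>\<in>classes. \<rho> \<le> size_scale \<kappa>} \<subseteq> {..N} \<times> PiE (UNIV::'n set) (\<lambda>_. {..N})"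
    by (auto simp: PiE_UNIV_domain)
  then show ?thesis by (rule finite_subset) (auto intro!: finite_PiE)
qed

text \<open>
  The top level lies between \<open>2 * w1 * T - total k\<close> and \<open>2 * w1 * T\<close>, so the scale and \<open>k\<close> leave only
  linearly many values of \<open>T\<close>.
\<close>

lemma window_class_count:
  assumes l: "0 < l" "l < 1" and \<rho>: "0 < \<rho>" and w1: "w1 > 0" "w1 = Max (range w)"
    and fin: "finite S"
    and S: "\<And>T. T \<in> S \<Longrightarrow> l * \<rho> \<le> size_scale (T, k) \<and> size_scale (T, k) \<le> \<rho>"
  shows "real (card S) \<le> (ln (1 / l) + real (total k)) / (2 * w1) + 1"
proof (rule card_nat_interval_le[OF fin, where u = "(real (total k) / (2 * real CARD('n)) - ln (8 * \<rho>)) / (2 * w1)"])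
  fix T assume "T \<in> S"
  let ?K = "real (total k)" and ?L = "top_level (T, k)" and ?d = "real CARD('n)"
  have s: "8 * (l * \<rho>) \<le> exp (?K / (2 * ?d) - ?L)" "exp (?K / (2 * ?d) - ?L) \<le> 8 * \<rho>"
    using S[OF \<open>T \<in> S\<close>] by (simp_all add: size_scale_def)
  have "ln (8 * (l * \<rho>)) \<le> ?K / (2 * ?d) - ?L" using s(1) l \<rho> by (intro ln_le_if_le_exp) auto
  moreover have "ln (8 * (l * \<rho>)) = ln (8 * \<rho>) - ln (1 / l)"
    using l \<rho> by (simp add: ln_mult ln_div)
  moreover have "?K / (2 * ?d) - ?L \<le> ln (8 * \<rho>)" using s(2) \<rho> by (simp add: ln_ge_iff)
  ultimately have L: "?K / (2 * ?d) - ln (8 * \<rho>) \<le> ?L" "?L \<le> ?K / (2 * ?d) - ln (8 * \<rho>) + ln (1 / l)"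
    by linarith+
  have "level (T, k) (thin_dir (T, k)) \<le> 2 * w (thin_dir (T, k)) * T" by (simp add: level_def)
  also have "\<dots> \<le> 2 * w1 * T" unfolding w1(2) by (intro mult_right_mono mult_left_mono Max_ge) auto
  finally have up: "?L \<le> 2 * w1 * T" by (simp add: level_thin_dir)
  have "w1 \<in> range w" unfolding w1(2) by (intro Max_in) auto
  then obtain i where i: "w i = w1" by auto
  have "k i \<le> total k" unfolding total_def by (rule member_le_sum) auto
  then have lo: "2 * w1 * T \<le> ?L + ?K" using level_le_top[of "(T, k)" i] i by (simp add: level_def)
  show "(?K / (2 * ?d) - ln (8 * \<rho>)) / (2 * w1) \<le> real T \<and>
        real T \<le> (?K / (2 * ?d) - ln (8 * \<rho>)) / (2 * w1) + (ln (1 / l) + ?K) / (2 * w1)"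
    using L up lo w1(1) unfolding add_divide_distrib[symmetric]
    by (simp only: pos_divide_le_eq pos_le_divide_eq mult_pos_pos zero_less_numeral) (simp add: mult_ac)
qed (use l w1 in simp)

lemma window_class_sum:
  assumes \<gamma>: "0 < \<gamma>" and l: "0 < l" "l < 1"
  shows "\<exists>M. \<forall>\<rho>>0. (\<Sum>\<kappa> | \<kappa> \<in> classes \<and> l * \<rho> \<le> size_scale \<kappa> \<and> size_scale \<kappa> \<le> \<rho>. thickness \<kappa> powr \<gamma>) \<le> M * \<rho> powr \<gamma>"
proof -
  define d where "d = real CARD('n)"
  have d: "d > 0" by (simp add: d_def)
  define w1 where "w1 = Max (range w)"
  have "w1 > 0"
  proof (rule ccontr)
    assume "\<not> w1 > 0"
    moreover have "w i \<le> w1" for i unfolding w1_def by (intro Max_ge) auto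
    ultimately have "w i = 0" for i using w_nonneg[of i] by (meson antisym not_le order.trans)
    then show False using w_sum by simp
  qed
  \<comment> \<open>The thickness is \<open>8 * exp 1\<close> times the scale times
    \<open>exp (- K / (2 * d))\<close>, so weights decay like \<open>exp (- 2 * a * K)\<close>. Half
    of this decay absorbs the number of values of \<open>T\<close>, linear in \<open>K\<close>; the
    other half makes the sum over \<open>k\<close> converge.\<close>
  define a where "a = \<gamma> / (4 * d)"
  have a: "a > 0" using \<gamma> d by (simp add: a_def)
  define C0 where "C0 = ln (1 / l) / (2 * w1) + 1"
  define C1 where "C1 = 1 / (2 * w1)"
  have C: "C0 \<ge> 0" "C1 \<ge> 0" using l \<open>w1 > 0\<close> by (simp_all add: C0_def C1_def)
  define C2 where "C2 = C0 + C1 / a"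
  have C2: "C0 + C1 * u \<le> C2 * exp (a * u)" if "u \<ge> 0" for u
  proof -
    have "1 \<le> exp (a * u)" using a that by simp
    moreover have "u \<le> exp (a * u) / a"
    proof -
      have "a * u \<le> exp (a * u)" using exp_ge_add_one_self[of "a * u"] by linarith
      then show ?thesis using a by (simp add: field_simps)
    qed
    ultimately have "C0 * 1 + C1 * u \<le> C0 * exp (a * u) + C1 * (exp (a * u) / a)"
      using C by (intro add_mono mult_left_mono)
    then show ?thesis by (simp add: C2_def algebra_simps)
  qed
  have C2n: "C2 \<ge> 0" using C a by (simp add: C2_def)
  define M where "M = (8 * exp 1) powr \<gamma> * (C2 * (1 / (1 - exp (- a))) ^ CARD('n))"
  have "(\<Sum>\<kappa> | \<kappa> \<in> classes \<and> l * \<rho> \<le> size_scale \<kappa> \<and> size_scale \<kappa> \<le> \<rho>. thickness \<kappa> powr \<gamma>) \<le> M * \<rho> powr \<gamma>"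
    if \<rho>: "\<rho> > 0" for \<rho>
  proof -
    define W where "W = {\<kappa>. \<kappa> \<in> classes \<and> l * \<rho> \<le> size_scale \<kappa> \<and> size_scale \<kappa> \<le> \<rho>}"
    have fin: "finite W"
      by (rule finite_subset[OF _ finite_large_classes[of "l * \<rho>"]]) (use l \<rho> in \<open>auto simp: W_def\<close>)
    have "thickness \<kappa> powr \<gamma> \<le> (8 * exp 1 * \<rho>) powr \<gamma> * exp (- 2 * a * real (total (snd \<kappa>)))" if "\<kappa> \<in> W" for \<kappa>
    proof -
      let ?K = "real (total (snd \<kappa>))"
      have "thickness \<kappa> = 8 * exp 1 * size_scale \<kappa> * exp (- ?K / (2 * d))"
        by (simp add: thickness_def size_scale_def d_def mult_exp_exp)
      also have "\<dots> \<le> 8 * exp 1 * \<rho> * exp (- ?K / (2 * d))"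
        using that by (intro mult_right_mono mult_left_mono) (auto simp: W_def)
      finally have "thickness \<kappa> powr \<gamma> \<le> (8 * exp 1 * \<rho> * exp (- ?K / (2 * d))) powr \<gamma>"
        using \<gamma> by (intro powr_mono2) (auto simp: thickness_def)
      also have "\<dots> = (8 * exp 1 * \<rho>) powr \<gamma> * exp (- ?K / (2 * d)) powr \<gamma>"
        using \<rho> by (intro powr_mult) 
      also have "exp (- ?K / (2 * d)) powr \<gamma> = exp (- 2 * a * ?K)"
        using d by (simp add: powr_def a_def)
      finally show ?thesis .
    qed
    then have "(\<Sum>\<kappa>\<in>W. thickness \<kappa> powr \<gamma>) \<le> (\<Sum>\<kappa>\<in>W. (8 * exp 1 * \<rho>) powr \<gamma> * exp (- 2 * a * real (total (snd \<kappa>))))"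
      by (rule sum_mono)
    also have "\<dots> = (8 * exp 1 * \<rho>) powr \<gamma> * (\<Sum>\<kappa>\<in>W. exp (- 2 * a * real (total (snd \<kappa>))))"
      by (simp add: sum_distrib_left)
    also have "(\<Sum>\<kappa>\<in>W. exp (- 2 * a * real (total (snd \<kappa>)))) =
        (\<Sum>k\<in>snd ` W. \<Sum>\<kappa>\<in>{\<kappa>\<in>W. snd \<kappa> = k}. exp (- 2 * a * real (total (snd \<kappa>))))"
      using fin by (intro sum.group[symmetric]) auto
    also have "\<dots> \<le> (\<Sum>k\<in>snd ` W. C2 * exp (- a * real (\<Sum>i\<in>UNIV. k i)))"
    proof (rule sum_mono)
      fix k assume "k \<in> snd ` W"
      let ?K = "real (total k)"
      let ?S = "fst ` {\<kappa>\<in>W. snd \<kappa> = k}"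
      have "finite ?S" using fin by (intro finite_imageI) simp
      moreover have "l * \<rho> \<le> size_scale (T, k) \<and> size_scale (T, k) \<le> \<rho>" if "T \<in> ?S" for T
        using that by (auto simp: W_def)
      ultimately have "real (card ?S) \<le> (ln (1 / l) + ?K) / (2 * w1) + 1"
        by (rule window_class_count[OF l \<rho> \<open>w1 > 0\<close> w1_def])
      also have "\<dots> = C0 + C1 * ?K" by (simp add: C0_def C1_def add_divide_distrib)
      also have "\<dots> \<le> C2 * exp (a * ?K)" by (rule C2) simp
      finally have c: "real (card {\<kappa>\<in>W. snd \<kappa> = k}) \<le> C2 * exp (a * ?K)"
        by (subst (asm) card_image) (auto simp: inj_on_def prod_eq_iff)
      have "(\<Sum>\<kappa>\<in>{\<kappa>\<in>W. snd \<kappa> = k}. exp (- 2 * a * real (total (snd \<kappa>)))) =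
          real (card {\<kappa>\<in>W. snd \<kappa> = k}) * exp (- 2 * a * ?K)" by simp
      also have "\<dots> \<le> C2 * exp (a * ?K) * exp (- 2 * a * ?K)"
        using c by (intro mult_right_mono) auto
      also have "\<dots> = C2 * exp (- a * ?K)"
        by (simp add: mult_exp_exp)
      finally show "(\<Sum>\<kappa>\<in>{\<kappa>\<in>W. snd \<kappa> = k}. exp (- 2 * a * real (total (snd \<kappa>)))) \<le> C2 * exp (- a * real (\<Sum>i\<in>UNIV. k i))"
        by (simp add: total_def)
    qed
    also have "\<dots> \<le> C2 * (1 / (1 - exp (- a))) ^ CARD('n)"
      unfolding sum_distrib_left[symmetric] using fin
      by (intro mult_left_mono sum_exp_multiindex_le a C2n) auto
    finally have "(\<Sum>\<kappa>\<in>W. thickness \<kappa> powr \<gamma>) \<le> (8 * exp 1 * \<rho>) powr \<gamma> * (C2 * (1 / (1 - exp (- a))) ^ CARD('n))"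
      by (simp add: mult_left_mono)
    also have "\<dots> = M * \<rho> powr \<gamma>"
      using \<rho> by (simp add: M_def powr_mult)
    finally show ?thesis by (simp add: W_def)
  qed
  then show ?thesis by blast
qed

end

section \<open>Badly approximable vectors\<close>

context weighted_embeddings
begin

text \<open>Rounding \<open>t\<close> up to \<open>T\<close> changes \<open>exp (- w i * t)\<close>
  by a factor of at most \<open>exp 1\<close>, because \<open>w i \<le> 1\<close>; the factor
  \<open>exp (- 1)\<close> in \<open>close\<close> compensates. \<open>k\<close> is the logarithmic
  defect rounded down.\<close>

lemma danger_class_exists:
  assumes \<epsilon>: "0 < \<epsilon>" and p: "algebraic_int p" and q: "algebraic_int q" "q \<noteq> 0" and t: "t \<ge> 0"
    and small_q: "\<And>i. \<bar>e i q\<bar> \<le> exp (w i * t)"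
    and close: "\<And>i. \<bar>e i q * x $ i + e i p\<bar> \<le> \<epsilon> * exp (- 1) * exp (- w i * t)"
  shows "\<exists>\<kappa>\<in>classes. x \<in> danger \<epsilon> \<kappa>"
proof -
  define T where "T = nat \<lceil>t\<rceil>"
  have T: "t \<le> real T" "real T \<le> t + 1" using t unfolding T_def by linarith+
  define k where "k i = nat \<lfloor>w i * real T - ln \<bar>e i q\<bar>\<rfloor>" for i
  have q0: "\<bar>e i q\<bar> > 0" for i using e_nonzero[OF q(2)] by simp
  have "ln \<bar>e i q\<bar> \<le> w i * real T" for i
  proof -
    have "ln \<bar>e i q\<bar> \<le> w i * t" using small_q q0 by (intro ln_le_if_le_exp) auto
    also have "\<dots> \<le> w i * real T" using T w_nonneg by (intro mult_left_mono) auto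
    finally show ?thesis .
  qed
  then have "real (k i) = of_int \<lfloor>w i * real T - ln \<bar>e i q\<bar>\<rfloor>" for i
    unfolding k_def by (simp add: of_nat_nat)
  then have k: "real (k i) \<le> w i * real T - ln \<bar>e i q\<bar>" "w i * real T - ln \<bar>e i q\<bar> < real (k i) + 1" for i
    by (simp_all add: of_int_floor_le)
  have "(T, k) \<in> classes"
  proof -
    have "0 \<le> ln (\<Prod>i\<in>UNIV. \<bar>e i q\<bar>)" using norm_ge_1[OF q] by simp
    also have "\<dots> = (\<Sum>i\<in>UNIV. ln \<bar>e i q\<bar>)" using e_nonzero[OF q(2)] by (intro ln_prod) auto
    also have "\<dots> \<le> (\<Sum>i\<in>UNIV. w i * real T - real (k i))"
      by (intro sum_mono) (use k(1) in \<open>simp add: algebra_simps\<close>)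
    also have "\<dots> = real T - real (total k)"
      by (simp add: sum_subtractf sum_distrib_right[symmetric] w_sum total_def)
    finally show ?thesis by (simp add: classes_def)
  qed
  moreover have "near_fraction \<epsilon> (T, k) p q x"
    unfolding near_fraction_def fst_conv snd_conv
  proof (intro conjI allI p q)
    fix i
    have e: "\<bar>e i q\<bar> = exp (ln \<bar>e i q\<bar>)" using q0 by simp
    show "exp (w i * real T - real (k i) - 1) < \<bar>e i q\<bar>" by (subst e) (use k(2)[of i] in simp)
    show "\<bar>e i q\<bar> \<le> exp (w i * real T - real (k i))" by (subst e) (use k(1)[of i] in simp)
    have "w i \<le> (\<Sum>i\<in>UNIV. w i)" by (rule member_le_sum) (auto simp: w_nonneg)
    then have "w i * (real T - t) \<le> 1 * 1" using T w_nonneg w_sum by (intro mult_mono) auto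
    then have "exp (- 1) * exp (- w i * t) \<le> exp (- w i * real T)"
      unfolding mult_exp_exp by (simp add: algebra_simps)
    then have "\<epsilon> * (exp (- 1) * exp (- w i * t)) \<le> \<epsilon> * exp (- w i * real T)"
      using \<epsilon> by (intro mult_left_mono) auto
    then show "\<bar>e i q * x $ i + e i p\<bar> \<le> \<epsilon> * exp (- w i * real T)"
      using close[of i] by simp
  qed
  ultimately show ?thesis by (auto simp: danger_def)
qed

lemma exists_e_ge_1:
  assumes "algebraic_int q" "q \<noteq> 0"
  shows "\<exists>i. \<bar>e i q\<bar> \<ge> 1"
proof (rule ccontr)
  assume n: "\<not> ?thesis"
  have "(\<Prod>i\<in>UNIV. \<bar>e i q\<bar>) = \<bar>e undefined q\<bar> * (\<Prod>i\<in>UNIV - {undefined}. \<bar>e i q\<bar>)"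
    by (rule prod.remove) auto
  also have "\<dots> \<le> \<bar>e undefined q\<bar> * 1"
    using n by (intro mult_left_mono prod_le_1) (auto simp: not_le less_imp_le)
  also have "\<dots> < 1" using n by (simp add: not_le)
  finally show False using norm_ge_1[OF assms] by simp
qed

sublocale strip_family classes danger thin_dir thickness size_scale "1/8"
proof
  show "\<exists>y. \<forall>x\<in>danger \<epsilon> \<kappa> \<inter> cball z \<rho>. \<bar>x $ thin_dir \<kappa> - y\<bar> \<le> \<epsilon> * thickness \<kappa>"
    if "\<epsilon> \<le> 1/8" "\<rho> \<le> size_scale \<kappa>" for \<kappa> \<epsilon> \<rho> z
    using danger_in_strip that by blast
qed (use finite_large_classes window_class_sum in \<open>auto simp: thickness_def size_scale_def\<close>)

end

text \<open>If the quality were smaller, then with \<open>H\<close> the weighted norm of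
  \<open>q\<close> and \<open>t = ln H\<close> the inequalities for both \<open>S1\<close> and
  \<open>S2\<close> would become the hypotheses of \<open>danger_class_exists\<close>.\<close>

lemma approx_quality_ge:
  fixes r :: "('k::field_char_0 \<Rightarrow> real) \<Rightarrow> real" and e :: "'n::finite \<Rightarrow> 'k \<Rightarrow> real"
  assumes we: "weighted_embeddings e (\<lambda>i. r (e i))"
    and e: "bij_betw e UNIV real_embeddings"
    and \<epsilon>: "0 < \<epsilon>" "\<epsilon> \<le> 1/8"
    and safe: "\<And>\<kappa>. \<kappa> \<in> weighted_embeddings.classes \<Longrightarrow> x \<notin> weighted_embeddings.danger e (\<lambda>i. r (e i)) \<epsilon> \<kappa>"
    and y: "\<And>i. y (e i) = x $ i"
    and pq: "algebraic_int p" "algebraic_int q" "q \<noteq> 0"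
  shows "\<epsilon> * exp (- 1) \<le> approx_quality r y q p"
proof (rule ccontr)
  interpret weighted_embeddings e "\<lambda>i. r (e i)" by (rule we)
  define \<epsilon>' where "\<epsilon>' = \<epsilon> * exp (- 1)"
  have "\<epsilon>' \<le> 1 * 1" unfolding \<epsilon>'_def using \<epsilon> by (intro mult_mono) auto
  then have \<epsilon>'1: "\<epsilon>' \<le> 1" by simp
  assume "\<not> \<epsilon> * exp (- 1) \<le> approx_quality r y q p"
  then have bad: "approx_quality r y q p < \<epsilon>'" by (simp add: \<epsilon>'_def)
  have fin: "finite (real_embeddings :: ('k \<Rightarrow> real) set)" using bij_betw_finite[OF e] by simp
  then have fin1: "finite (S1 r)" and fin2: "finite (S2 r)" by (auto simp: S1_def S2_def)
  have emb: "e i \<in> real_embeddings" for i using e by (auto simp: bij_betw_def)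
  define H where "H = weighted_norm r q"
  have in1: "e i \<in> S1 r \<longleftrightarrow> r (e i) > 0" for i using emb by (simp add: S1_def)
  have in2: "e i \<in> S2 r \<longleftrightarrow> r (e i) = 0" for i
    using emb w_nonneg[of i] by (auto simp: S2_def S1_def)
  have c1: "H powr r (e i) * \<bar>e i q * x $ i + e i p\<bar> < \<epsilon>'" if "r (e i) > 0" for i
  proof -
    have "H powr r (e i) * \<bar>e i q * x $ i + e i p\<bar>
      \<le> (MAX \<sigma>\<in>S1 r. weighted_norm r q powr r \<sigma> * \<bar>\<sigma> q * y \<sigma> + \<sigma> p\<bar>)"
      unfolding H_def y[symmetric] using fin1 that in1 by (intro Max_ge) auto
    also have "\<dots> \<le> approx_quality r y q p" by (simp add: approx_quality_def Let_def)
    finally show ?thesis using bad by simp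
  qed
  have c2: "max \<bar>e i q * x $ i + e i p\<bar> \<bar>e i q\<bar> < \<epsilon>'" if "r (e i) = 0" for i
  proof -
    have "max \<bar>e i q * x $ i + e i p\<bar> \<bar>e i q\<bar> \<le> (MAX \<sigma>\<in>S2 r. max \<bar>\<sigma> q * y \<sigma> + \<sigma> p\<bar> \<bar>\<sigma> q\<bar>)"
      unfolding y[symmetric] using fin2 that in2 by (intro Max_ge) auto
    also have "\<dots> \<le> approx_quality r y q p"
      using that in2 by (auto simp: approx_quality_def Let_def)
    finally show ?thesis using bad by simp
  qed
  have H: "\<bar>e i q\<bar> powr (1 / r (e i)) \<le> H" if "r (e i) > 0" for i
    unfolding H_def weighted_norm_def using fin1 that in1 by (intro Max_ge) auto
  \<comment> \<open>On \<open>S2\<close> all conjugates of \<open>q\<close> are below 1, so this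
    \<open>j\<close> belongs to \<open>S1\<close>; that gives \<open>H \<ge> 1\<close>, hence
    \<open>ln H \<ge> 0\<close>.\<close>
  obtain j where j: "\<bar>e j q\<bar> \<ge> 1" using exists_e_ge_1[OF pq(2,3)] by blast
  then have "r (e j) > 0" using c2[of j] \<epsilon>'1 w_nonneg[of j] by (cases "r (e j) = 0") auto
  then have H1: "H \<ge> 1"
    using H[of j] ge_one_powr_ge_zero[OF j, of "1 / r (e j)"] by simp
  have "\<exists>\<kappa>\<in>classes. x \<in> danger \<epsilon> \<kappa>"
  proof (rule danger_class_exists[OF \<epsilon>(1) pq])
    show "ln H \<ge> 0" using H1 by simp
    show "\<bar>e i q\<bar> \<le> exp (r (e i) * ln H)" for i
    proof (cases "r (e i) = 0")
      case True
      then show ?thesis using c2[of i] \<epsilon>'1 by simp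
    next
      case False
      then have r: "r (e i) > 0" using w_nonneg[of i] by simp
      have "\<bar>e i q\<bar> = (\<bar>e i q\<bar> powr (1 / r (e i))) powr r (e i)" using r by (simp add: powr_powr)
      also have "\<dots> \<le> H powr r (e i)" using H[OF r] r by (intro powr_mono2) auto
      finally show ?thesis using H1 by (simp add: powr_def)
    qed
    show "\<bar>e i q * x $ i + e i p\<bar> \<le> \<epsilon> * exp (- 1) * exp (- r (e i) * ln H)" for i
    proof (cases "r (e i) = 0")
      case True
      then show ?thesis using c2[of i] by (simp add: \<epsilon>'_def)
    next
      case False
      then have "r (e i) > 0" using w_nonneg[of i] by simp
      from c1[OF this] have "exp (r (e i) * ln H) * \<bar>e i q * x $ i + e i p\<bar> \<le> \<epsilon>'"
        using H1 by (simp add: powr_def)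
      then have "exp (- r (e i) * ln H) * (exp (r (e i) * ln H) * \<bar>e i q * x $ i + e i p\<bar>) \<le> exp (- r (e i) * ln H) * \<epsilon>'"
        by (intro mult_left_mono) auto
      then show ?thesis
        unfolding mult.assoc[symmetric] mult_exp_exp by (simp add: \<epsilon>'_def mult.commute)
    qed
  qed
  then show False using safe by blast
qed

theorem proposition3p5:
  fixes r :: "('k::field_char_0 \<Rightarrow> real) \<Rightarrow> real"
    and d :: nat
    and e :: "'n::finite \<Rightarrow> 'k \<Rightarrow> real"
  assumes "number_field_of_degree TYPE('k) d"
    and "totally_real TYPE('k)"
    and "\<And>\<sigma>. \<sigma> \<in> real_embeddings \<Longrightarrow> r \<sigma> \<ge> 0"
    and "(\<Sum>\<sigma>\<in>real_embeddings. r \<sigma>) = 1"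
    and "bij_betw e UNIV real_embeddings"
  shows "CARD('n) = d \<and> HAW (coordinates e ` Bad r)"
proof -
  obtain B :: "'k set" where "finite_dimensional_vector_space (\<lambda>(c::rat) (x::'k). of_rat c * x) B" and d: "card B = d"
    using assms(1) by (auto simp: number_field_of_degree_def)
  then have B: "number_field_basis B" by (simp add: number_field_basis_def)
  then interpret K: number_field_basis B .
  have emb: "e i \<in> real_embeddings" for i using assms(5) by (auto simp: bij_betw_def)
  have we: "weighted_embeddings e (\<lambda>i. r (e i))"
  proof
    show "(\<Sum>i\<in>UNIV. r (e i)) = 1" using sum.reindex_bij_betw[OF assms(5), of r] assms(4) by simp
    show "(\<Prod>i\<in>UNIV. \<bar>e i q\<bar>) \<ge> 1" if "algebraic_int q" "q \<noteq> 0" for q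
      using bounded_denom_powers_norm_ge_1[OF B assms(2,5) K.algebraic_int_bounded_denom_powers] that .
    show "(\<Prod>i\<in>UNIV. \<bar>e i (p * q' - p' * q)\<bar>) \<ge> 1"
      if "algebraic_int p" "algebraic_int q" "algebraic_int p'" "algebraic_int q'" "p * q' \<noteq> p' * q" for p q p' q'
    proof -
      note bd = K.algebraic_int_bounded_denom_powers
      have "K.bounded_denom_powers (p * q' + - (p' * q))"
        using that by (intro K.bounded_denom_powers_add K.bounded_denom_powers_minus K.bounded_denom_powers_mult bd)
      then show ?thesis
        using bounded_denom_powers_norm_ge_1[OF B assms(2,5), of "p * q' - p' * q"] that by simp
    qed
  qed (use emb assms(3) in \<open>auto simp: field_embeddings_def\<close>)
  then interpret weighted_embeddings e "\<lambda>i. r (e i)" .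
  have sub: "{x. \<exists>\<epsilon>. 0 < \<epsilon> \<and> \<epsilon> \<le> 1/8 \<and> (\<forall>\<kappa>\<in>classes. x \<notin> danger \<epsilon> \<kappa>)} \<subseteq> coordinates e ` Bad r"
  proof safe
    fix x \<epsilon> assume \<epsilon>: "0 < (\<epsilon>::real)" "\<epsilon> \<le> 1/8" and safe: "\<forall>\<kappa>\<in>classes. x \<notin> danger \<epsilon> \<kappa>"
    \<comment> \<open>\<open>Bad\<close> consists of extensional functions, hence the restriction to
      the embeddings.\<close>
    define y where "y = (\<lambda>\<sigma>\<in>real_embeddings. x $ inv e \<sigma>)"
    have y: "y (e i) = x $ i" for i using emb assms(5) by (simp add: y_def bij_betw_def)
    \<comment> \<open>A lower bound for the infimum requires a nonempty index set.\<close>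
    have "(1, 0) \<in> (ring_of_integers - {0}) \<times> (ring_of_integers :: 'k set)"
      by (auto simp: ring_of_integers_def int_imp_algebraic_int)
    then have "\<epsilon> * exp (- 1) \<le> (INF (q, p) \<in> (ring_of_integers - {0}) \<times> ring_of_integers. approx_quality r y q p)"
      using approx_quality_ge[OF we assms(5) \<epsilon> _ y] safe
      by (intro cINF_greatest) (auto simp: ring_of_integers_def)
    moreover have "0 < \<epsilon> * exp (- 1)" using \<epsilon> by simp
    ultimately have "y \<in> Bad r" by (auto simp: Bad_def y_def)
    moreover have "x = coordinates e y" by (simp add: coordinates_def y vec_eq_iff)
    ultimately show "x \<in> coordinates e ` Bad r" by blast
  qed
  have "HAW (coordinates e ` Bad r)"
    unfolding HAW_def using beta_HAW_avoiding[OF _ _ sub] by blast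
  then show ?thesis using number_field_basis_card[OF B assms(2,5)] d by simp
qed

end
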